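(* For every arc-connected compact set $X\subset\mathbb{R}^2$ that is not an axis-aligned rectangle and every integer $k\geq 1$, there is a triangle-free family $\mathcal{F}$ of sets in the plane, each obtained by translation and independent horizontal and vertical scaling of $X$, such that $\chi(\mathcal{F})>k$.
   Context: The intersection graph of a family of sets $\mathcal{F}$ is the graph with vertex set $\mathcal{F}$ in which two distinct members are adjacent if and only if they intersect. A family is identified with its intersection graph: $\chi(\mathcal{F})$ denotes the chromatic number of the intersection graph, and $\mathcal{F}$ is triangle-free if no three distinct members pairwise intersect. A set obtained by translation and independent horizontal and vertical scaling of $X$ is a set of the form $\{(ax+b,\,cy+d):(x,y)\in X\}$ with $a,c>0$ and $b,d\in\mathbb{R}$ (only positive scale factors are used; no reflections). Arc-connected sets are understood to be non-empty. An axis-aligned rectangle is a set $[a,b]\times[c,d]$ with $a\leq b$ and $c\leq d$; degenerate rectangles (single points, horizontal segments and vertical segments) count as axis-aligned rectangles. *)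

theory Defs
  imports "HOL-Analysis.Analysis" "HOL-Library.Extended_Nat"
begin

definition arc_connected :: "'a::topological_space set \<Rightarrow> bool" where
  "arc_connected S \<longleftrightarrow> S \<noteq> {} \<and>
     (\<forall>x\<in>S. \<forall>y\<in>S. x \<noteq> y \<longrightarrow>
        (\<exists>g. arc g \<and> path_image g \<subseteq> S \<and> pathstart g = x \<and> pathfinish g = y))"

definition axis_aligned_rectangle :: "(real \<times> real) set \<Rightarrow> bool" where
  "axis_aligned_rectangle R \<longleftrightarrow> (\<exists>a b c d. a \<le> b \<and> c \<le> d \<and> R = {a..b} \<times> {c..d})"

definition scaled_translate_of :: "(real \<times> real) set \<Rightarrow> (real \<times> real) set \<Rightarrow> bool" where
  "scaled_translate_of X Y \<longleftrightarrow>
     (\<exists>a b c d. 0 < a \<and> 0 < c \<and> Y = (\<lambda>(x, y). (a * x + b, c * y + d)) ` X)"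

text \<open>A graph is a pair of its vertex set and its set of edges, each edge being a
  two-element set of vertices. Vertex sets may be infinite.\<close>

type_synonym 'v graph = "'v set \<times> 'v set set"

definition intersection_graph :: "'a set set \<Rightarrow> 'a set graph" where
  "intersection_graph F = (F, {{A, B} | A B. A \<in> F \<and> B \<in> F \<and> A \<noteq> B \<and> A \<inter> B \<noteq> {}})"

definition proper_coloring :: "'v graph \<Rightarrow> nat \<Rightarrow> ('v \<Rightarrow> nat) \<Rightarrow> bool" where
  "proper_coloring G n f \<longleftrightarrow>
     (\<forall>v\<in>fst G. f v < n) \<and>
     (\<forall>u\<in>fst G. \<forall>v\<in>fst G. {u, v} \<in> snd G \<longrightarrow> f u \<noteq> f v)"

text \<open>The infimum of the empty set is \<open>\<infinity>\<close>: this is the value when no finite number of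
  colors suffices.\<close>

definition chromatic_number :: "'v graph \<Rightarrow> enat" where
  "chromatic_number G = Inf {enat n | n. \<exists>f. proper_coloring G n f}"

definition triangle_free :: "'a set set \<Rightarrow> bool" where
  "triangle_free F \<longleftrightarrow>
     \<not> (\<exists>A\<in>F. \<exists>B\<in>F. \<exists>C\<in>F. A \<noteq> B \<and> B \<noteq> C \<and> A \<noteq> C \<and>
          A \<inter> B \<noteq> {} \<and> B \<inter> C \<noteq> {} \<and> A \<inter> C \<noteq> {})"

end

theory Submission
  imports Defs
begin

text \<open>
  A probe is a horizontal strip, reaching the right end of the drawing, that is empty at its left
  end and is crossed from bottom to top by every set it meets, these sets being pairwise disjoint.
  By induction on \<open>k\<close>, there is a triangle-free family with probes of disjoint heights
  such that every proper coloring shows at least \<open>k\<close> colors in one of the probes.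

  A point of the bounding box outside \<open>X\<close> has a rectangular neighbourhood \<open>R\<close> missed by \<open>X\<close>.
  A path in \<open>X\<close> crossing the horizontal strip through \<open>R\<close> from bottom to top passes on one side
  of \<open>R\<close>, by symmetry on the right. Given a probe \<open>P\<close>, stretch a copy \<open>D\<close> of \<open>X\<close> inside the strip
  of \<open>P\<close> so that all sets met by \<open>P\<close> are crossed by the part of \<open>D\<close> left of the image of \<open>R\<close>.
  Then \<open>P\<close> splits into a probe meeting the same sets as \<open>P\<close> but not \<open>D\<close>, and a probe starting in the
  image of \<open>R\<close> and meeting only \<open>D\<close>. If \<open>P\<close> shows a set \<open>A\<close> of \<open>k\<close> colors, then \<open>D\<close> has a color
  outside \<open>A\<close>; hence for any given \<open>k\<close> colors some new probe shows yet another color. Placing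
  scaled copies of this enlarged family at the empty ends of all probes of the original family
  forces \<open>k + 1\<close> colors.
\<close>

section \<open>Triangle-freeness and proper colorings\<close>

text \<open>Three pairwise intersecting sets cannot come from different groups when sets of
  different groups are disjoint, so every triangle lies within one group.\<close>

lemma triangle_free_UN:
  assumes "\<And>i. i \<in> I \<Longrightarrow> triangle_free (\<G> i)"
    and "\<And>i j A B. i \<in> I \<Longrightarrow> j \<in> I \<Longrightarrow> i \<noteq> j \<Longrightarrow> A \<in> \<G> i \<Longrightarrow> B \<in> \<G> j \<Longrightarrow> A \<inter> B = {}"
  shows "triangle_free (\<Union>i\<in>I. \<G> i)"
  unfolding triangle_free_def
proof clarify
  fix A B C i j l
  assume *: "i \<in> I" "A \<in> \<G> i" "j \<in> I" "B \<in> \<G> j" "l \<in> I" "C \<in> \<G> l"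
    "A \<noteq> B" "B \<noteq> C" "A \<noteq> C" "A \<inter> B \<noteq> {}" "B \<inter> C \<noteq> {}" "A \<inter> C \<noteq> {}"
  then have "i = j" "j = l" using assms(2) by blast+
  then show False using * assms(1)[of i] unfolding triangle_free_def by blast
qed

lemma triangle_free_Un:
  assumes "triangle_free F" "triangle_free G"
    and "\<And>A B. A \<in> F \<Longrightarrow> B \<in> G \<Longrightarrow> A \<inter> B = {}"
  shows "triangle_free (F \<union> G)"
proof -
  have "triangle_free (\<Union>b\<in>UNIV. if b then F else G)"
    by (rule triangle_free_UN) (use assms in \<open>auto split: if_splits\<close>)
  then show ?thesis by (simp add: UNIV_bool Un_commute)
qed

lemma inj_image_disjoint_iff:
  assumes "inj \<phi>"
  shows "\<phi> ` A \<inter> \<phi> ` B = {} \<longleftrightarrow> A \<inter> B = {}"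
  by (metis assms image_Int image_is_empty)

lemma triangle_free_image:
  assumes "inj \<phi>" "triangle_free F"
  shows "triangle_free ((`) \<phi> ` F)"
  using assms(2) unfolding triangle_free_def
  by (simp add: inj_image_disjoint_iff[OF assms(1)] inj_image_eq_iff[OF assms(1)])

lemma proper_coloring_intersection_graph:
  "proper_coloring (intersection_graph F) n f \<longleftrightarrow>
     (\<forall>A\<in>F. f A < n) \<and> (\<forall>A\<in>F. \<forall>B\<in>F. A \<noteq> B \<longrightarrow> A \<inter> B \<noteq> {} \<longrightarrow> f A \<noteq> f B)"
proof -
  have "{A, B} \<in> snd (intersection_graph F) \<longleftrightarrow> A \<noteq> B \<and> A \<inter> B \<noteq> {}"
    if "A \<in> F" "B \<in> F" for A B
    using that by (auto simp: intersection_graph_def doubleton_eq_iff)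
  moreover have "fst (intersection_graph F) = F" by (simp add: intersection_graph_def)
  ultimately show ?thesis unfolding proper_coloring_def by (simp cong: ball_cong) blast
qed

lemma proper_coloring_subset:
  assumes "proper_coloring (intersection_graph F) n f" "G \<subseteq> F"
  shows "proper_coloring (intersection_graph G) n f"
  using assms unfolding proper_coloring_intersection_graph by (meson subsetD)

text \<open>Pulls a coloring of a moved copy back to the original family, so that what is known
  about the original applies to each copy.\<close>

lemma proper_coloring_image:
  assumes "inj \<phi>" "proper_coloring (intersection_graph ((`) \<phi> ` F)) n f"
  shows "proper_coloring (intersection_graph F) n (f \<circ> (`) \<phi>)"
  using assms(2) unfolding proper_coloring_intersection_graph
  by (simp add: inj_image_disjoint_iff[OF assms(1)] inj_image_eq_iff[OF assms(1)])

lemma finite_colors: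
  assumes "proper_coloring (intersection_graph F) n f" "S \<subseteq> F"
  shows "finite (f ` S)"
proof (rule finite_subset)
  show "f ` S \<subseteq> {..<n}"
    using assms unfolding proper_coloring_intersection_graph by blast
qed simp

section \<open>Affine copies and crossing paths\<close>

text \<open>The parameters are ordered as in \<open>scaled_translate_of\<close>; unfolding both
  definitions identifies the two notions.\<close>

definition aff :: "real \<Rightarrow> real \<Rightarrow> real \<Rightarrow> real \<Rightarrow> real \<times> real \<Rightarrow> real \<times> real" where
  "aff a b c d = (\<lambda>(x, y). (a * x + b, c * y + d))"

lemma inj_aff: "a > 0 \<Longrightarrow> c > 0 \<Longrightarrow> inj (aff a b c d)"
  by (auto simp: aff_def inj_def)

lemma aff_aff: "aff a b c d (aff a' b' c' d' p) = aff (a * a') (a * b' + b) (c * c') (c * d' + d) p"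
  by (cases p) (simp add: aff_def algebra_simps)

lemma scaled_translate_of_aff:
  "a > 0 \<Longrightarrow> c > 0 \<Longrightarrow> scaled_translate_of X (aff a b c d ` X)"
  unfolding scaled_translate_of_def aff_def by blast

lemma scaled_translate_of_aff_image:
  assumes "scaled_translate_of X Y" "a > 0" "c > 0"
  shows "scaled_translate_of X (aff a b c d ` Y)"
proof -
  obtain a' b' c' d' where "0 < a'" "0 < c'" "Y = aff a' b' c' d' ` X"
    using assms(1) unfolding scaled_translate_of_def aff_def by blast
  then show ?thesis
    using assms(2,3) scaled_translate_of_aff[of "a * a'" "c * c'" X "a * b' + b" "c * d' + d"]
    by (simp add: image_image aff_aff)
qed

section \<open>Vertical crossings of a rectangle\<close>

text \<open>The crossing is witnessed by a path inside the rectangle, so that the Fashoda theorem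
  can be applied to it.\<close>

definition crosses_vertically :: "(real \<times> real) set \<Rightarrow> real \<Rightarrow> real \<Rightarrow> real \<Rightarrow> real \<Rightarrow> bool" where
  "crosses_vertically Y x0 x1 y0 y1 \<longleftrightarrow> (\<exists>g. path g \<and> path_image g \<subseteq> Y \<inter> {x0..x1} \<times> {y0..y1} \<and>
     snd (pathstart g) = y0 \<and> snd (pathfinish g) = y1)"

lemma crosses_vertically_mono:
  assumes "crosses_vertically Y x0 x1 y0 y1" "Y \<subseteq> Z" "x0' \<le> x0" "x1 \<le> x1'"
  shows "crosses_vertically Z x0' x1' y0 y1"
proof -
  have "Y \<inter> {x0..x1} \<times> {y0..y1} \<subseteq> Z \<inter> {x0'..x1'} \<times> {y0..y1}"
    using assms(2-4) by auto
  then show ?thesis using assms(1) unfolding crosses_vertically_def by (elim exE conjE) (intro exI conjI; auto)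
qed

text \<open>The path is cut at its first visit \<open>t2\<close> to height \<open>z1\<close> and at
  its last visit \<open>t1\<close> to height \<open>z0\<close> before \<open>t2\<close>. In between,
  the intermediate value theorem keeps it at heights from \<open>z0\<close> to
  \<open>z1\<close>.\<close>

lemma crosses_vertically_shrink:
  assumes "crosses_vertically Y x0 x1 y0 y1" "y0 \<le> z0" "z0 < z1" "z1 \<le> y1"
  shows "crosses_vertically Y x0 x1 z0 z1"
proof -
  obtain g where g: "path g" "path_image g \<subseteq> Y \<inter> {x0..x1} \<times> {y0..y1}"
    "snd (pathstart g) = y0" "snd (pathfinish g) = y1"
    using assms(1) unfolding crosses_vertically_def by blast
  define h where "h = snd \<circ> g"
  have h: "continuous_on {0..1} h"
    unfolding h_def using g(1) by (auto simp: path_def intro!: continuous_on_compose continuous_intros)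
  have h01: "h 0 = y0" "h 1 = y1"
    using g by (auto simp: h_def pathstart_def pathfinish_def)
  define T2 where "T2 = {0..1} \<inter> h -` {z1}"
  have "closed T2" unfolding T2_def
    using h by (intro continuous_closed_preimage) auto
  then have "compact T2" unfolding T2_def
    by (metis Int_commute compact_Icc closed_Int_compact inf.idem inf_assoc)
  moreover have "T2 \<noteq> {}"
    using IVT'[of h 0 z1 1] h h01 assms by (force simp: T2_def)
  ultimately obtain t2 where t2: "t2 \<in> T2" "\<And>t. t \<in> T2 \<Longrightarrow> t2 \<le> t"
    using compact_attains_inf[of T2] by blast
  define T1 where "T1 = {0..t2} \<inter> h -` {z0}"
  have h': "continuous_on {0..t2} h"
    using h by (rule continuous_on_subset) (use t2 in \<open>auto simp: T2_def\<close>)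
  have "closed T1" unfolding T1_def
    using h' by (intro continuous_closed_preimage) auto
  then have "compact T1" unfolding T1_def
    by (metis Int_commute compact_Icc closed_Int_compact inf.idem inf_assoc)
  moreover have "T1 \<noteq> {}"
    using IVT'[of h 0 z0 t2] h' h01 assms t2 by (force simp: T1_def T2_def)
  ultimately obtain t1 where t1: "t1 \<in> T1" "\<And>t. t \<in> T1 \<Longrightarrow> t \<le> t1"
    using compact_attains_sup[of T1] by blast
  have t: "0 \<le> t1" "t1 \<le> t2" "t2 \<le> 1" "h t1 = z0" "h t2 = z1"
    using t1(1) t2(1) by (auto simp: T1_def T2_def)
  \<comment> \<open>A larger height before \<open>t2\<close> would force an earlier visit to
    \<open>z1\<close>, since the path starts at \<open>y0\<close>, below \<open>z1\<close>. The
    argument for \<open>low\<close> is the mirror image with \<open>t1\<close>.\<close>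
  have up: "h t \<le> z1" if "t1 \<le> t" "t \<le> t2" for t
  proof (rule ccontr)
    assume n: "\<not> h t \<le> z1"
    have "continuous_on {0..t} h"
      using h by (rule continuous_on_subset) (use t that in auto)
    then have "\<exists>s\<ge>0. s \<le> t \<and> h s = z1"
      by (intro IVT') (use n that t h01 assms in simp_all)
    then obtain s where s: "0 \<le> s" "s \<le> t" "h s = z1" by blast
    then have "t2 \<le> s" using t2(2)[of s] that t by (auto simp: T2_def)
    then have "s = t" using s that by linarith
    then show False using s n by simp
  qed
  have low: "z0 \<le> h t" if "t1 \<le> t" "t \<le> t2" for t
  proof (rule ccontr)
    assume n: "\<not> z0 \<le> h t"
    have "continuous_on {t..t2} h"
      using h by (rule continuous_on_subset) (use t that in auto)
    then have "\<exists>s\<ge>t. s \<le> t2 \<and> h s = z0"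
      by (intro IVT') (use n that t assms in simp_all)
    then obtain s where s: "t \<le> s" "s \<le> t2" "h s = z0" by blast
    then have "s \<le> t1" using t1(2)[of s] that t by (auto simp: T1_def)
    then have "s = t" using s that by linarith
    then show False using s n by simp
  qed
  have "path (subpath t1 t2 g)"
    using g(1) t by (intro path_subpath) auto
  moreover have "path_image (subpath t1 t2 g) \<subseteq> Y \<inter> {x0..x1} \<times> {z0..z1}"
  proof
    fix p assume "p \<in> path_image (subpath t1 t2 g)"
    then obtain s where s: "t1 \<le> s" "s \<le> t2" "p = g s"
      using t by (auto simp: path_image_subpath)
    then have "p \<in> path_image g" using t by (auto simp: path_image_def)
    then have "p \<in> Y \<inter> {x0..x1} \<times> {y0..y1}" using g(2) by blast
    then show "p \<in> Y \<inter> {x0..x1} \<times> {z0..z1}"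
      using up[of s] low[of s] s by (cases p) (auto simp: h_def)
  qed
  moreover have "snd (pathstart (subpath t1 t2 g)) = z0" "snd (pathfinish (subpath t1 t2 g)) = z1"
    using t by (auto simp: h_def)
  ultimately show ?thesis unfolding crosses_vertically_def by blast
qed

lemma crosses_vertically_aff:
  assumes "crosses_vertically Y x0 x1 y0 y1" "a > 0" "c > 0"
  shows "crosses_vertically (aff a b c d ` Y) (a * x0 + b) (a * x1 + b) (c * y0 + d) (c * y1 + d)"
proof -
  obtain g where g: "path g" "path_image g \<subseteq> Y \<inter> {x0..x1} \<times> {y0..y1}"
    "snd (pathstart g) = y0" "snd (pathfinish g) = y1"
    using assms(1) unfolding crosses_vertically_def by blast
  have "path (aff a b c d \<circ> g)"
    unfolding aff_def case_prod_unfold using g(1)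
    by (intro path_continuous_image) (auto intro!: continuous_intros)
  moreover have "path_image (aff a b c d \<circ> g) \<subseteq>
      aff a b c d ` Y \<inter> {a * x0 + b..a * x1 + b} \<times> {c * y0 + d..c * y1 + d}"
    using g(2) assms(2,3) unfolding path_image_compose by (fastforce simp: aff_def)
  moreover have "snd (pathstart (aff a b c d \<circ> g)) = c * y0 + d"
    "snd (pathfinish (aff a b c d \<circ> g)) = c * y1 + d"
    using g(3,4) by (auto simp: pathstart_compose pathfinish_compose aff_def case_prod_unfold)
  ultimately show ?thesis unfolding crosses_vertically_def by blast
qed

lemma crosses_vertically_meets:
  assumes "crosses_vertically Y x0 x1 y0 y1"
  shows "Y \<inter> {x0..x1} \<times> {y0..y1} \<noteq> {}"
  using assms unfolding crosses_vertically_def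
  by (metis pathstart_in_path_image subset_empty empty_iff)

lemma image_meets_iff: "\<phi> ` A \<inter> B \<noteq> {} \<longleftrightarrow> (\<exists>p\<in>A. \<phi> p \<in> B)"
  by blast

lemma disjoint_subset: "A \<inter> C = {} \<Longrightarrow> B \<subseteq> C \<Longrightarrow> A \<inter> B = {}"
  by blast

text \<open>This is the Fashoda theorem, which is stated in \<open>real^2\<close>; the injective map
  \<open>\<iota>\<close> carries the paths there and the common point back.\<close>

lemma crossing_paths_meet:
  fixes f g :: "real \<Rightarrow> real \<times> real"
  assumes "path f" "path g"
    and "path_image f \<subseteq> {a..b} \<times> {c..d}" "path_image g \<subseteq> {a..b} \<times> {c..d}"
    and "fst (pathstart f) = a" "fst (pathfinish f) = b"
    and "snd (pathstart g) = c" "snd (pathfinish g) = d"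
  shows "path_image f \<inter> path_image g \<noteq> {}"
proof -
  define \<iota> :: "real \<times> real \<Rightarrow> real^2" where "\<iota> p = (\<chi> i. if i = 1 then fst p else snd p)" for p
  have nth: "\<iota> p $ 1 = fst p" "\<iota> p $ 2 = snd p" for p by (auto simp: \<iota>_def)
  have "continuous_on A \<iota>" for A
    unfolding \<iota>_def
  proof (rule continuous_on_vec_lambda)
    show "continuous_on A (\<lambda>x::real \<times> real. if i = 1 then fst x else snd x)" for i :: 2
      by (cases "i = 1") (auto intro: continuous_on_fst continuous_on_snd)
  qed
  then have paths: "path (\<iota> \<circ> f)" "path (\<iota> \<circ> g)"
    using assms(1,2) by (auto intro: path_continuous_image)
  have box: "\<iota> ` ({a..b} \<times> {c..d}) \<subseteq> cbox (\<iota> (a, c)) (\<iota> (b, d))"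
    by (simp add: image_subset_iff mem_box_cart forall_2 nth)
  have inj: "inj \<iota>" by (metis injI nth prod_eq_iff)
  obtain z where "z \<in> path_image (\<iota> \<circ> f)" "z \<in> path_image (\<iota> \<circ> g)"
  proof (rule fashoda[OF paths])
    show "path_image (\<iota> \<circ> f) \<subseteq> cbox (\<iota> (a, c)) (\<iota> (b, d))"
      "path_image (\<iota> \<circ> g) \<subseteq> cbox (\<iota> (a, c)) (\<iota> (b, d))"
      using assms(3,4) box unfolding path_image_compose by blast+
  qed (auto simp: pathstart_compose pathfinish_compose nth assms)
  then show ?thesis
    unfolding path_image_compose by (metis IntI empty_iff imageE inj injD)
qed

section \<open>Probes\<close>

definition met :: "(real \<times> real) set set \<Rightarrow> real \<Rightarrow> real \<Rightarrow> real \<Rightarrow> real \<Rightarrow> (real \<times> real) set set" where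
  "met F x0 x1 y0 y1 = {Y \<in> F. Y \<inter> {x0..x1} \<times> {y0..y1} \<noteq> {}}"

text \<open>A probe is the strip \<open>{x0..M} \<times> {y0..y1}\<close>; its part \<open>{x0..x1} \<times> {y0..y1}\<close> is the free
  space into which further sets can be inserted.\<close>

definition probe :: "(real \<times> real) set set \<Rightarrow> real \<Rightarrow> real \<times> real \<times> real \<times> real \<Rightarrow> bool" where
  "probe F M = (\<lambda>(x0, x1, y0, y1). 0 < x0 \<and> x0 < x1 \<and> x1 < M \<and> 0 < y0 \<and> y0 < y1 \<and> y1 < 1 \<and>
     (\<forall>Y\<in>F. Y \<inter> {x0..x1} \<times> {y0..y1} = {}) \<and>
     (\<forall>Y\<in>met F x0 M y0 y1. \<forall>Z\<in>met F x0 M y0 y1. Y \<noteq> Z \<longrightarrow> Y \<inter> Z = {}) \<and>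
     (\<forall>Y\<in>met F x0 M y0 y1. crosses_vertically Y x1 M y0 y1))"

lemma probeD:
  assumes "probe F M (x0, x1, y0, y1)"
  shows "0 < x0" "x0 < x1" "x1 < M" "0 < y0" "y0 < y1" "y1 < 1"
    and "Y \<in> F \<Longrightarrow> Y \<inter> {x0..x1} \<times> {y0..y1} = {}"
    and "Y \<in> met F x0 M y0 y1 \<Longrightarrow> Z \<in> met F x0 M y0 y1 \<Longrightarrow> Y \<noteq> Z \<Longrightarrow> Y \<inter> Z = {}"
    and "Y \<in> met F x0 M y0 y1 \<Longrightarrow> crosses_vertically Y x1 M y0 y1"
  using assms by (simp_all add: probe_def)

definition probe_met :: "(real \<times> real) set set \<Rightarrow> real \<Rightarrow> real \<times> real \<times> real \<times> real \<Rightarrow> (real \<times> real) set set" where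
  "probe_met F M = (\<lambda>(x0, x1, y0, y1). met F x0 M y0 y1)"

text \<open>The whole horizontal strip, not only the part right of \<open>x0\<close>: whatever is
  inserted within one band then misses every probe with a disjoint band.\<close>

definition band :: "real \<times> real \<times> real \<times> real \<Rightarrow> (real \<times> real) set" where
  "band = (\<lambda>(x0, x1, y0, y1). UNIV \<times> {y0..y1})"

text \<open>The invariant of the induction. The height of the box is normalized to 1, while its
  width \<open>M\<close> is free because splitting probes extends the drawing to the right.\<close>

definition probed_family :: "(real \<times> real) set \<Rightarrow> (real \<times> real) set set \<Rightarrow>
    (real \<times> real \<times> real \<times> real) set \<Rightarrow> real \<Rightarrow> bool" where
  "probed_family X F \<P> M \<longleftrightarrow> 0 < M \<and>
     (\<forall>Y\<in>F. scaled_translate_of X Y \<and> Y \<subseteq> {0<..<M} \<times> {0<..<1}) \<and> triangle_free F \<and>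
     (\<forall>P\<in>\<P>. probe F M P) \<and> (\<forall>P\<in>\<P>. \<forall>Q\<in>\<P>. P \<noteq> Q \<longrightarrow> band P \<inter> band Q = {})"

definition forces_colors :: "(real \<times> real) set set \<Rightarrow> (real \<times> real \<times> real \<times> real) set \<Rightarrow> real \<Rightarrow> nat \<Rightarrow> bool" where
  "forces_colors F \<P> M k \<longleftrightarrow> (\<forall>n f. proper_coloring (intersection_graph F) n f \<longrightarrow>
     (\<exists>P\<in>\<P>. k \<le> card (f ` probe_met F M P)))"

text \<open>The set \<open>A\<close> stands for the colors already shown by an outer probe once a
  copy of \<open>F\<close> sits in its free space.\<close>

definition forces_new_color :: "(real \<times> real) set set \<Rightarrow> (real \<times> real \<times> real \<times> real) set \<Rightarrow> real \<Rightarrow> nat \<Rightarrow> bool" where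
  "forces_new_color F \<P> M k \<longleftrightarrow> (\<forall>n f A. proper_coloring (intersection_graph F) n f \<longrightarrow>
     finite A \<longrightarrow> k \<le> card A \<longrightarrow> (\<exists>P\<in>\<P>. Suc k \<le> card (A \<union> f ` probe_met F M P)))"

text \<open>Sets that miss the band of a probe are not seen by it; insertions elsewhere thus do not
  affect what it meets.\<close>

lemma probe_met_superfamily:
  assumes "F \<subseteq> G" "\<And>Y. Y \<in> G - F \<Longrightarrow> Y \<inter> band P = {}"
  shows "probe_met G N P = probe_met F N P"
proof -
  obtain x0 x1 y0 y1 where P: "P = (x0, x1, y0, y1)" by (cases P) auto
  have "Y \<in> F" if "Y \<in> G" "Y \<inter> {x0..N} \<times> {y0..y1} \<noteq> {}" for Y
    using assms(2)[of Y] that by (fastforce simp: P band_def)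
  then show ?thesis using assms(1) by (auto simp: probe_met_def met_def P)
qed

lemma probe_superfamily:
  assumes "F \<subseteq> G" "\<And>Y. Y \<in> G - F \<Longrightarrow> Y \<inter> band P = {}" "probe F N P"
  shows "probe G N P"
proof -
  obtain x0 x1 y0 y1 where P: "P = (x0, x1, y0, y1)" by (cases P) auto
  have "Y \<inter> {x0..x1} \<times> {y0..y1} = {}" if "Y \<in> G" for Y
    using assms(2)[of Y] assms(3) that by (fastforce simp: P band_def probe_def)
  moreover have "met G x0 N y0 y1 = met F x0 N y0 y1"
    using probe_met_superfamily[of F G P N] assms(1,2) by (simp add: P probe_met_def)
  ultimately show ?thesis using assms(3) by (simp add: P probe_def)
qed

lemma probed_familyD:
  assumes "probed_family X F \<P> M"
  shows "0 < M" "Y \<in> F \<Longrightarrow> scaled_translate_of X Y" "Y \<in> F \<Longrightarrow> Y \<subseteq> {0<..<M} \<times> {0<..<1}"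
    "triangle_free F" "P \<in> \<P> \<Longrightarrow> probe F M P"
    "P \<in> \<P> \<Longrightarrow> Q \<in> \<P> \<Longrightarrow> P \<noteq> Q \<Longrightarrow> band P \<inter> band Q = {}"
  using assms unfolding probed_family_def by blast+

section \<open>Splitting a probe by a copy of a notched set\<close>

text \<open>The shape of \<open>X\<close> enters the construction in this form: a gap strictly
  between the left and right sides of an enclosing box, a crossing of the strip of the gap on its
  right, and a path joining the left side to the right side, which makes a wide copy hit every set
  that crosses its box from bottom to top.\<close>

definition notched :: "(real \<times> real) set \<Rightarrow> bool" where
  "notched X \<longleftrightarrow> (\<exists>a b c d u u' v v'. X \<subseteq> {a..b} \<times> {c..d} \<and>
     a < u \<and> u < u' \<and> u' < b \<and> c \<le> v \<and> v < v' \<and> v' \<le> d \<and>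
     X \<inter> {u..u'} \<times> {v..v'} = {} \<and> crosses_vertically X u' b v v' \<and>
     (\<exists>g. path g \<and> path_image g \<subseteq> X \<and> fst (pathstart g) = a \<and> fst (pathfinish g) = b))"

lemma notchedI:
  assumes "X \<subseteq> {a..b} \<times> {c..d}" "a < u" "u < u'" "u' < b" "c \<le> v" "v < v'" "v' \<le> d"
    and "X \<inter> {u..u'} \<times> {v..v'} = {}" "crosses_vertically X u' b v v'"
    and "path g" "path_image g \<subseteq> X" "fst (pathstart g) = a" "fst (pathfinish g) = b"
  shows "notched X"
  unfolding notched_def
  by (rule exI[of _ a], rule exI[of _ b], rule exI[of _ c], rule exI[of _ d], rule exI[of _ u],
      rule exI[of _ u'], rule exI[of _ v], rule exI[of _ v'], intro conjI exI[of _ g]) fact+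

text \<open>The copy \<open>D\<close> of \<open>X\<close> is so wide that everything met by the probe \<open>P\<close> lies to the left of
  the gap of \<open>D\<close>; the probe \<open>L\<close> starts in that gap, while \<open>U\<close> passes above \<open>D\<close>.\<close>

definition splits_probe :: "(real \<times> real) set \<Rightarrow> (real \<times> real) set set \<Rightarrow> real \<Rightarrow> real \<times> real \<times> real \<times> real \<Rightarrow>
    real \<Rightarrow> (real \<times> real) set \<Rightarrow> real \<times> real \<times> real \<times> real \<Rightarrow> real \<times> real \<times> real \<times> real \<Rightarrow> bool" where
  "splits_probe X F M P N D L U \<longleftrightarrow>
     scaled_translate_of X D \<and> D \<subseteq> {0<..<N} \<times> {0<..<1} \<and> D \<subseteq> band P \<and> D \<notin> F \<and>
     (\<forall>Y\<in>F. D \<inter> Y \<noteq> {} \<longleftrightarrow> Y \<in> probe_met F M P) \<and>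
     band L \<subseteq> band P \<and> band U \<subseteq> band P \<and> band L \<inter> band U = {} \<and>
     probe (insert D F) N L \<and> probe (insert D F) N U \<and>
     probe_met (insert D F) N L = {D} \<and> probe_met (insert D F) N U = probe_met F M P"

lemma splits_probeD:
  assumes "splits_probe X F M P N D L U"
  shows "scaled_translate_of X D" "D \<subseteq> {0<..<N} \<times> {0<..<1}" "D \<subseteq> band P" "D \<notin> F"
    and "Y \<in> F \<Longrightarrow> D \<inter> Y \<noteq> {} \<longleftrightarrow> Y \<in> probe_met F M P"
    and "band L \<subseteq> band P" "band U \<subseteq> band P" "band L \<inter> band U = {}"
    and "probe (insert D F) N L" "probe (insert D F) N U"
    and "probe_met (insert D F) N L = {D}" "probe_met (insert D F) N U = probe_met F M P"
  using assms by (simp_all add: splits_probe_def)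

text \<open>\<open>N\<close> is chosen before \<open>F\<close> and \<open>P\<close>, so that all
  probes of a family can be split within one common box. \<open>D\<close> meets each set seen by
  \<open>P\<close> because its path from left to right must hit the vertical crossing of that set;
  it meets no other set of \<open>F\<close> because it lies in the strip of \<open>P\<close> and
  right of \<open>x0\<close>.\<close>

lemma ex_splits_probe:
  assumes "notched X" "0 < M"
  obtains N where "M < N"
    and "\<And>F P. (\<And>Y. Y \<in> F \<Longrightarrow> Y \<subseteq> {0<..<M} \<times> {0<..<1}) \<Longrightarrow> probe F M P \<Longrightarrow>
      \<exists>D L U. splits_probe X F M P N D L U"
proof -
  obtain a b c d u u' v v' g where X: "X \<subseteq> {a..b} \<times> {c..d}"
    and ord: "a < u" "u < u'" "u' < b" "c \<le> v" "v < v'" "v' \<le> d"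
    and gap: "X \<inter> {u..u'} \<times> {v..v'} = {}" and cross: "crosses_vertically X u' b v v'"
    and g: "path g" "path_image g \<subseteq> X" "fst (pathstart g) = a" "fst (pathfinish g) = b"
    using assms(1) unfolding notched_def by blast
  \<comment> \<open>With this scale the gap of \<open>D\<close> starts at distance \<open>M\<close>
    from the left side of \<open>D\<close>, hence beyond all sets of \<open>F\<close>, wherever in
    the free space \<open>D\<close> begins.\<close>
  define \<alpha> where "\<alpha> = M / (u - a)"
  have \<alpha>: "\<alpha> > 0" "\<alpha> * (u - a) = M" using ord assms(2) by (auto simp: \<alpha>_def)
  \<comment> \<open>Leaves room for the full width of \<open>D\<close>, whose left side will lie at
    some \<open>s < M\<close>.\<close>
  define N where "N = M + \<alpha> * (b - a)"
  have less: "\<alpha> * (u - a) < \<alpha> * (u' - a)" "\<alpha> * (u' - a) < \<alpha> * (b - a)"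
    using \<alpha> ord by (auto intro: mult_strict_left_mono)
  show thesis
  proof (rule that[of N])
    show "M < N" using \<alpha> ord by (simp add: N_def)
    fix F P assume F: "\<And>Y. Y \<in> F \<Longrightarrow> Y \<subseteq> {0<..<M} \<times> {0<..<1}" and P': "probe F M P"
    obtain x0 x1 y0 y1 where P: "P = (x0, x1, y0, y1)" by (cases P) auto
    note probe = probeD[OF P'[unfolded P]]
    have x: "0 < x0" "x0 < x1" "x1 < M" and y: "0 < y0" "y0 < y1" "y1 < 1"
      using probe by simp_all
    \<comment> \<open>\<open>D\<close> begins inside the free space: right of the start of
      \<open>P\<close>, and left of the crossings, which lie right of \<open>x1\<close>.\<close>
    define s where "s = (x0 + x1) / 2"
    have s: "x0 < s" "s < x1" using x by (auto simp: s_def)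
    \<comment> \<open>\<open>D\<close> and \<open>L\<close> occupy the lower third of the strip,
      \<open>U\<close> the upper third; the middle third separates them.\<close>
    define h where "h = (y1 - y0) / 3"
    have h: "0 < h" "y0 + h < y0 + 2 * h" "y0 + 2 * h < y1" using y by (auto simp: h_def field_simps)
    define \<mu> where "\<mu> = h / (d - c)"
    have \<mu>: "\<mu> > 0" "\<mu> * (d - c) = h" using h ord by (auto simp: \<mu>_def)
    define \<psi> where "\<psi> = aff \<alpha> (s - \<alpha> * a) \<mu> (y0 - \<mu> * c)"
    have \<psi>: "\<psi> p = (s + \<alpha> * (fst p - a), y0 + \<mu> * (snd p - c))" for p
      by (cases p) (simp add: \<psi>_def aff_def algebra_simps)
    define D where "D = \<psi> ` X"
    define z0 where "z0 = s + \<alpha> * (u - a)"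
    define z1 where "z1 = s + \<alpha> * (u' - a)"
    define w0 where "w0 = y0 + \<mu> * (v - c)"
    define w1 where "w1 = y0 + \<mu> * (v' - c)"
    define e where "e = s + \<alpha> * (b - a)"
    have z: "M < z0" "z0 < z1" "z1 < e" "e < N"
      using less \<alpha> s x by (auto simp: z0_def z1_def e_def N_def)
    have w: "y0 \<le> w0" "w0 < w1" "w1 \<le> y0 + h"
      using \<mu> ord by (auto simp: w0_def w1_def mult_strict_left_mono mult_left_mono simp flip: \<mu>(2))
    have \<psi>box: "\<psi> p \<in> {s..e} \<times> {y0..y0 + h}" if "p \<in> {a..b} \<times> {c..d}" for p
      using that \<alpha>(1) \<mu>(1) by (auto simp: \<psi> e_def mult_left_mono simp flip: \<mu>(2))
    then have Dbox: "D \<subseteq> {s..e} \<times> {y0..y0 + h}" unfolding D_def using X by blast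
    have D1: "scaled_translate_of X D"
      unfolding D_def \<psi>_def using \<alpha> \<mu> by (intro scaled_translate_of_aff)
    have D2: "D \<subseteq> {0<..<N} \<times> {0<..<1}" "D \<subseteq> band P"
      using Dbox s x z y h by (force simp: P band_def)+
    have path: "path (\<psi> \<circ> g)"
      unfolding \<psi>_def aff_def case_prod_unfold using g(1)
      by (intro path_continuous_image) (auto intro!: continuous_intros)
    have pathD: "path_image (\<psi> \<circ> g) \<subseteq> D"
      using g(2) by (auto simp: D_def path_image_compose)
    have path_ends: "fst (pathstart (\<psi> \<circ> g)) = s" "fst (pathfinish (\<psi> \<circ> g)) = e"
      using g(3,4) by (auto simp: pathstart_compose pathfinish_compose \<psi> e_def)
    \<comment> \<open>The path in \<open>D\<close> ends at \<open>e\<close>, beyond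
      \<open>M\<close>, where no set of \<open>F\<close> reaches.\<close>
    have "D \<noteq> Y" if "Y \<in> F" for Y
    proof
      assume "D = Y"
      have "pathfinish (\<psi> \<circ> g) \<in> D" using pathD by auto
      then have "pathfinish (\<psi> \<circ> g) \<in> {0<..<M} \<times> {0<..<1}"
        using F[OF that] \<open>D = Y\<close> by blast
      then show False using path_ends(2) z by (auto simp: mem_Times_iff)
    qed
    then have D3: "D \<notin> F" by blast
    have D4: "D \<inter> Y \<noteq> {} \<longleftrightarrow> Y \<in> probe_met F M P" if Y: "Y \<in> F" for Y
    proof
      assume "D \<inter> Y \<noteq> {}"
      then obtain p where p: "p \<in> D" "p \<in> Y" by blast
      then have "p \<in> {s..e} \<times> {y0..y0 + h}" "p \<in> {0<..<M} \<times> {0<..<1}"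
        using Dbox F[OF Y] by blast+
      then have "p \<in> {x0..M} \<times> {y0..y1}" using s h by (auto simp: mem_Times_iff)
      then show "Y \<in> probe_met F M P" using p Y by (auto simp: probe_met_def met_def P)
    next
      assume "Y \<in> probe_met F M P"
      then have "crosses_vertically Y x1 M y0 y1"
        using probe(9) by (simp add: probe_met_def P)
      then have "crosses_vertically Y x1 M y0 (y0 + h)"
        by (rule crosses_vertically_shrink) (use h in auto)
      then obtain f where f: "path f" "path_image f \<subseteq> Y \<inter> {x1..M} \<times> {y0..y0 + h}"
        "snd (pathstart f) = y0" "snd (pathfinish f) = y0 + h"
        unfolding crosses_vertically_def by blast
      \<comment> \<open>Within the box of \<open>D\<close>, one path joins the vertical sides and
        the other the horizontal sides.\<close>
      have "path_image (\<psi> \<circ> g) \<inter> path_image f \<noteq> {}"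
      proof (rule crossing_paths_meet[OF path f(1) _ _ path_ends f(3,4)])
        show "path_image (\<psi> \<circ> g) \<subseteq> {s..e} \<times> {y0..y0 + h}" using pathD Dbox by blast
        have "{x1..M} \<times> {y0..y0 + h} \<subseteq> {s..e} \<times> {y0..y0 + h}" using s z by auto
        then show "path_image f \<subseteq> {s..e} \<times> {y0..y0 + h}" using f(2) by blast
      qed
      then show "D \<inter> Y \<noteq> {}" using pathD f(2) by blast
    qed
    \<comment> \<open>The free space of \<open>L\<close> is the image of the gap, right of
      everything in \<open>F\<close>, so \<open>L\<close> sees \<open>D\<close> alone;
      \<open>U\<close> keeps the horizontal extent of the free space of \<open>P\<close>.\<close>
    define L where "L = (z0, z1, w0, w1)"
    define U where "U = (x0, x1, y0 + 2 * h, y1)"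
    have bands: "band L \<subseteq> band P" "band U \<subseteq> band P" "band L \<inter> band U = {}"
      using w h by (auto simp: L_def U_def P band_def)
    have F_right: "Y \<inter> {r..r'} \<times> B = {}" if "Y \<in> F" "M < r" for Y r r' and B :: "real set"
      using F[OF that(1)] that(2) by fastforce
    have crossD: "crosses_vertically D z1 N w0 w1"
    proof (rule crosses_vertically_mono)
      have "crosses_vertically D (\<alpha> * u' + (s - \<alpha> * a)) (\<alpha> * b + (s - \<alpha> * a))
          (\<mu> * v + (y0 - \<mu> * c)) (\<mu> * v' + (y0 - \<mu> * c))"
        unfolding D_def \<psi>_def using cross \<alpha>(1) \<mu>(1) by (rule crosses_vertically_aff)
      then show "crosses_vertically D z1 e w0 w1"
        by (simp add: z1_def e_def w0_def w1_def algebra_simps)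
    qed (use z in auto)
    have gapD: "D \<inter> {z0..z1} \<times> {w0..w1} = {}"
    proof -
      have "q \<notin> {z0..z1} \<times> {w0..w1}" if "q \<in> D" for q
      proof
        assume q: "q \<in> {z0..z1} \<times> {w0..w1}"
        obtain p where p: "p \<in> X" "q = \<psi> p" using \<open>q \<in> D\<close> unfolding D_def by blast
        have "p \<in> {u..u'} \<times> {v..v'}"
          using q \<alpha>(1) \<mu>(1) by (cases p) (simp add: p(2) \<psi> z0_def z1_def w0_def w1_def)
        then show False using p(1) gap by blast
      qed
      then show ?thesis by (meson disjoint_iff)
    qed
    have metL: "met (insert D F) z0 N w0 w1 = {D}"
    proof -
      have "crosses_vertically D z0 N w0 w1"
        using crossD z by (intro crosses_vertically_mono[OF crossD]) auto
      then show ?thesis using crosses_vertically_meets F_right z by (fastforce simp: met_def)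
    qed
    have L: "probe (insert D F) N L" "probe_met (insert D F) N L = {D}"
    proof -
      have "\<forall>Y\<in>insert D F. Y \<inter> {z0..z1} \<times> {w0..w1} = {}" using gapD F_right z by blast
      then show "probe (insert D F) N L"
        using metL crossD z w h x y by (auto simp: L_def probe_def)
      show "probe_met (insert D F) N L = {D}" by (simp add: L_def probe_met_def metL)
    qed
    have DU: "D \<inter> A \<times> {y0 + 2 * h..y1} = {}" for A using Dbox h by fastforce
    have metU: "met (insert D F) x0 N (y0 + 2 * h) y1 = met F x0 M y0 y1"
    proof (intro equalityI subsetI)
      fix Y assume "Y \<in> met (insert D F) x0 N (y0 + 2 * h) y1"
      then have Y: "Y \<in> F" "Y \<inter> {x0..N} \<times> {y0 + 2 * h..y1} \<noteq> {}"
        using DU by (auto simp: met_def)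
      then obtain p where p: "p \<in> Y" "p \<in> {x0..N} \<times> {y0 + 2 * h..y1}" by blast
      then have "p \<in> {x0..M} \<times> {y0..y1}" using F[OF Y(1)] h by (fastforce simp: mem_Times_iff)
      then show "Y \<in> met F x0 M y0 y1" using p Y by (auto simp: met_def)
    next
      fix Y assume Y: "Y \<in> met F x0 M y0 y1"
      then have "crosses_vertically Y x1 M y0 y1" using probe(9) by blast
      then have "crosses_vertically Y x1 M (y0 + 2 * h) y1"
        by (rule crosses_vertically_shrink) (use h in auto)
      then have "crosses_vertically Y x0 N (y0 + 2 * h) y1"
        by (rule crosses_vertically_mono) (use x z in auto)
      then show "Y \<in> met (insert D F) x0 N (y0 + 2 * h) y1"
        using Y crosses_vertically_meets by (auto simp: met_def)
    qed
    have U: "probe (insert D F) N U" "probe_met (insert D F) N U = probe_met F M P"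
    proof -
      have sub: "{x0..x1} \<times> {y0 + 2 * h..y1} \<subseteq> {x0..x1} \<times> {y0..y1}" using h by auto
      have 1: "\<forall>Y\<in>insert D F. Y \<inter> {x0..x1} \<times> {y0 + 2 * h..y1} = {}"
      proof
        fix Y assume "Y \<in> insert D F"
        then consider "Y = D" | "Y \<inter> {x0..x1} \<times> {y0..y1} = {}" using probe(7) by blast
        then show "Y \<inter> {x0..x1} \<times> {y0 + 2 * h..y1} = {}"
          using DU disjoint_subset[OF _ sub] by cases simp_all
      qed
      have 2: "crosses_vertically Y x1 N (y0 + 2 * h) y1" if "Y \<in> met F x0 M y0 y1" for Y
      proof -
        have "crosses_vertically Y x1 M y0 y1" using probe(9) that by blast
        then have "crosses_vertically Y x1 M (y0 + 2 * h) y1"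
          by (rule crosses_vertically_shrink) (use h in auto)
        then show ?thesis by (rule crosses_vertically_mono) (use x z in auto)
      qed
      have 3: "\<forall>Y\<in>met F x0 M y0 y1. \<forall>Z\<in>met F x0 M y0 y1. Y \<noteq> Z \<longrightarrow> Y \<inter> Z = {}"
        using probe(8) by blast
      show "probe (insert D F) N U"
        unfolding probe_def U_def case_prod_conv metU
        using 1 2 3 x y z h by (intro conjI ballI) auto
      show "probe_met (insert D F) N U = probe_met F M P"
        by (simp add: U_def P probe_met_def metU)
    qed
    have "splits_probe X F M P N D L U"
      unfolding splits_probe_def by (intro conjI ballI D1 D2 D3 D4 bands L U)
    then show "\<exists>D L U. splits_probe X F M P N D L U" by blast
  qed
qed

section \<open>The induction on the number of colors\<close>

text \<open>A triangle contains at most one inserted set since these are pairwise disjoint, and its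
  other two corners would be intersecting sets of \<open>F\<close> met by the same inserted
  set.\<close>

lemma triangle_free_insertions:
  assumes "triangle_free F"
    and "\<And>D E. D \<in> \<D> \<Longrightarrow> E \<in> \<D> \<Longrightarrow> D \<noteq> E \<Longrightarrow> D \<inter> E = {}"
    and "\<And>D Y Z. D \<in> \<D> \<Longrightarrow> Y \<in> F \<Longrightarrow> Z \<in> F \<Longrightarrow> Y \<noteq> Z \<Longrightarrow> D \<inter> Y \<noteq> {} \<Longrightarrow> D \<inter> Z \<noteq> {} \<Longrightarrow> Y \<inter> Z = {}"
  shows "triangle_free (F \<union> \<D>)"
  unfolding triangle_free_def
proof clarify
  fix A B C
  assume *: "A \<in> F \<union> \<D>" "B \<in> F \<union> \<D>" "C \<in> F \<union> \<D>" "A \<noteq> B" "B \<noteq> C" "A \<noteq> C"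
    and i: "A \<inter> B \<noteq> {}" "B \<inter> C \<noteq> {}" "A \<inter> C \<noteq> {}"
  then consider "A \<in> F" "B \<in> F" "C \<in> F" | "A \<in> \<D>" "B \<in> F" "C \<in> F" | "A \<in> F" "B \<in> \<D>" "C \<in> F"
    | "A \<in> F" "B \<in> F" "C \<in> \<D>"
    using assms(2) by blast
  then show False
  proof cases
    case 1
    then show ?thesis using assms(1) * i unfolding triangle_free_def by blast
  next
    case 2
    then show ?thesis using assms(3)[of A B C] * i by blast
  next
    case 3
    then show ?thesis using assms(3)[of B A C] * i by blast
  next
    case 4
    then show ?thesis using assms(3)[of C A B] * i by blast
  qed
qed

lemma probe_met_disjoint:
  assumes "probe F M P" "Y \<in> probe_met F M P" "Z \<in> probe_met F M P" "Y \<noteq> Z"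
  shows "Y \<inter> Z = {}"
  using assms by (cases P) (simp add: probe_def probe_met_def)

lemma probe_met_subset: "probe_met F M P \<subseteq> F"
  by (cases P) (auto simp: probe_met_def met_def)

text \<open>All probes are split at once: \<open>D P\<close> is added for each \<open>P\<close>, and
  \<open>P\<close> is replaced by \<open>L P\<close> and \<open>U P\<close>. Disjoint bands keep the
  insertions from interfering, and the sets of \<open>F\<close> met by \<open>D P\<close> are
  pairwise disjoint because \<open>P\<close> is a probe.\<close>

lemma ex_forces_new_color:
  assumes "notched X" "probed_family X F \<P> M" "forces_colors F \<P> M k"
  shows "\<exists>G \<Q> N. probed_family X G \<Q> N \<and> forces_new_color G \<Q> N k"
proof -
  note F = probed_familyD[OF assms(2)]
  obtain N where N: "M < N" and copy:
    "\<And>F P. (\<And>Y. Y \<in> F \<Longrightarrow> Y \<subseteq> {0<..<M} \<times> {0<..<1}) \<Longrightarrow> probe F M P \<Longrightarrow>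
      \<exists>D L U. splits_probe X F M P N D L U"
    using ex_splits_probe[OF assms(1) F(1)] by metis
  have "\<forall>P\<in>\<P>. \<exists>D L U. splits_probe X F M P N D L U"
    using copy[OF F(3) F(5)] by blast
  then obtain D L U where split: "\<And>P. P \<in> \<P> \<Longrightarrow> splits_probe X F M P N (D P) (L P) (U P)"
    by metis
  note D = splits_probeD(1-5)[OF split]
  note bands = splits_probeD(6-8)[OF split]
  note probes = splits_probeD(9,10)[OF split]
  note mets = splits_probeD(11,12)[OF split]
  define G where "G = F \<union> D ` \<P>"
  define \<Q> where "\<Q> = L ` \<P> \<union> U ` \<P>"
  have sub: "insert (D P) F \<subseteq> G" if "P \<in> \<P>" for P using that by (auto simp: G_def)
  \<comment> \<open>Such a \<open>Y\<close> is \<open>D Q\<close> for another probe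
    \<open>Q\<close>, hence confined to a band disjoint from that of \<open>P\<close>.\<close>
  have rest: "Y \<inter> band (L P) = {}" "Y \<inter> band (U P) = {}"
    if P: "P \<in> \<P>" and Y: "Y \<in> G - insert (D P) F" for P Y
  proof -
    obtain Q where Q: "Q \<in> \<P>" "Y = D Q" "Q \<noteq> P" using Y unfolding G_def by blast
    then have "Y \<inter> band P = {}" using D(3)[OF Q(1)] F(6)[OF Q(1) P Q(3)] by blast
    then show "Y \<inter> band (L P) = {}" "Y \<inter> band (U P) = {}" using bands[OF P] by blast+
  qed
  have mets': "probe_met G N (L P) = {D P}" "probe_met G N (U P) = probe_met F M P" if "P \<in> \<P>" for P
    using probe_met_superfamily[OF sub[OF that] rest(1)[OF that]]
      probe_met_superfamily[OF sub[OF that] rest(2)[OF that]] mets[OF that] by auto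
  have "probed_family X G \<Q> N"
    unfolding probed_family_def
  proof (intro conjI ballI impI)
    show "0 < N" using F(1) N by simp
  next
    fix Y assume "Y \<in> G"
    then show "scaled_translate_of X Y" using F(2) D(1) by (auto simp: G_def)
  next
    fix Y assume "Y \<in> G"
    have sub_box: "{0<..<M} \<times> {0<..<1} \<subseteq> {0<..<N} \<times> {0<..<1::real}" using N by auto
    consider "Y \<in> F" | P where "P \<in> \<P>" "Y = D P" using \<open>Y \<in> G\<close> unfolding G_def by blast
    then show "Y \<subseteq> {0<..<N} \<times> {0<..<1}"
    proof cases
      case 1
      then show ?thesis using F(3) sub_box by (meson order_trans)
    next
      case 2
      then show ?thesis using D(2) by simp
    qed
  next
    show "triangle_free G"
      unfolding G_def
    proof (rule triangle_free_insertions[OF F(4)])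
      fix A B assume "A \<in> D ` \<P>" "B \<in> D ` \<P>" "A \<noteq> B"
      then obtain P Q where "P \<in> \<P>" "A = D P" "Q \<in> \<P>" "B = D Q" "P \<noteq> Q" by blast
      then show "A \<inter> B = {}" using D(3)[of P] D(3)[of Q] F(6)[of P Q] by blast
    next
      fix A Y Z assume "A \<in> D ` \<P>" "Y \<in> F" "Z \<in> F" "Y \<noteq> Z" "A \<inter> Y \<noteq> {}" "A \<inter> Z \<noteq> {}"
      then obtain P where "P \<in> \<P>" "Y \<in> probe_met F M P" "Z \<in> probe_met F M P" using D(5) by blast
      then show "Y \<inter> Z = {}" using probe_met_disjoint F(5) \<open>Y \<noteq> Z\<close> by blast
    qed
  next
    fix R assume "R \<in> \<Q>"
    then show "probe G N R"
      using probe_superfamily[OF sub rest(1) probes(1)] probe_superfamily[OF sub rest(2) probes(2)]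
      by (auto simp: \<Q>_def)
  next
    fix R S assume RS: "R \<in> \<Q>" "S \<in> \<Q>" "R \<noteq> S"
    obtain P Q where P: "P \<in> \<P>" "R = L P \<or> R = U P" and Q: "Q \<in> \<P>" "S = L Q \<or> S = U Q"
      using RS by (auto simp: \<Q>_def)
    show "band R \<inter> band S = {}"
    proof (cases "P = Q")
      case True
      then show ?thesis using P Q RS(3) bands(3)[OF P(1)] by blast
    next
      case False
      then show ?thesis using P Q F(6)[OF P(1) Q(1)] bands(1,2)[OF P(1)] bands(1,2)[OF Q(1)] by blast
    qed
  qed
  moreover have "forces_new_color G \<Q> N k"
    unfolding forces_new_color_def
  proof (intro allI impI)
    fix n f and A :: "nat set" assume f: "proper_coloring (intersection_graph G) n f" and A: "finite A" "k \<le> card A"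
    have "proper_coloring (intersection_graph F) n f"
      using proper_coloring_subset[OF f] by (simp add: G_def)
    then obtain P where P: "P \<in> \<P>" "k \<le> card (f ` probe_met F M P)"
      and fin: "finite (f ` probe_met F M P)"
      using assms(3) finite_colors probe_met_subset unfolding forces_colors_def by blast
    show "\<exists>R\<in>\<Q>. Suc k \<le> card (A \<union> f ` probe_met G N R)"
    \<comment> \<open>In the first case the colors shown by \<open>P\<close> are exactly
      \<open>A\<close> by counting, and \<open>D P\<close>, which meets all these sets, has a color
      outside \<open>A\<close>, shown by \<open>L P\<close>. Otherwise \<open>A\<close> has more
      than \<open>k\<close> elements or \<open>P\<close> shows a color outside \<open>A\<close>, and
      \<open>U P\<close> suffices.\<close>
    proof (cases "f ` probe_met F M P \<subseteq> A \<and> card A = k")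
      case True
      then have A_eq: "f ` probe_met F M P = A"
        using P(2) A(1) by (metis card_subset_eq card_mono le_antisym)
      have "f (D P) \<noteq> f Y" if Y: "Y \<in> probe_met F M P" for Y
      proof -
        have "Y \<in> F" using Y probe_met_subset by blast
        then have "D P \<inter> Y \<noteq> {}" "D P \<noteq> Y" using D(4,5)[OF P(1)] Y by blast+
        moreover have "D P \<in> G" "Y \<in> G" using P(1) \<open>Y \<in> F\<close> by (auto simp: G_def)
        ultimately show ?thesis using f unfolding proper_coloring_intersection_graph by blast
      qed
      then have "f (D P) \<notin> A" using A_eq by blast
      then have "Suc k \<le> card (A \<union> f ` probe_met G N (L P))"
        using A by (simp add: mets' P(1))
      then show ?thesis using P(1) by (auto simp: \<Q>_def)
    next
      case False
      have "Suc k \<le> card (A \<union> f ` probe_met F M P)"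
      proof (cases "f ` probe_met F M P \<subseteq> A")
        case True
        then show ?thesis using False A by (simp add: Un_absorb2)
      next
        case False
        then have "A \<subset> A \<union> f ` probe_met F M P" by blast
        then have "card A < card (A \<union> f ` probe_met F M P)"
          using A(1) fin by (intro psubset_card_mono) auto
        then show ?thesis using A(2) by simp
      qed
      then have "Suc k \<le> card (A \<union> f ` probe_met G N (U P))" by (simp add: mets' P(1))
      then show ?thesis using P(1) by (auto simp: \<Q>_def)
    qed
  qed
  ultimately show ?thesis by blast
qed

section \<open>Placing a family in the free space of a probe\<close>

text \<open>\<open>\<phi>\<close> moves the sets and \<open>\<sigma>\<close> the probes. A moved
  probe runs on to the right end \<open>M\<close> of the outer drawing; this is why it sees the sets
  met by \<open>P\<close> in addition to moved sets.\<close>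

definition places_copy :: "(real \<times> real) set \<Rightarrow> (real \<times> real) set set \<Rightarrow> real \<Rightarrow> real \<times> real \<times> real \<times> real \<Rightarrow>
    (real \<times> real) set set \<Rightarrow> (real \<times> real \<times> real \<times> real) set \<Rightarrow> real \<Rightarrow> (real \<times> real \<Rightarrow> real \<times> real) \<Rightarrow>
    (real \<times> real \<times> real \<times> real \<Rightarrow> real \<times> real \<times> real \<times> real) \<Rightarrow> bool" where
  "places_copy X F M P G \<Q> N \<phi> \<sigma> \<longleftrightarrow> inj \<phi> \<and>
     (\<forall>Y\<in>G. scaled_translate_of X (\<phi> ` Y)) \<and> (\<forall>Y\<in>G. \<phi> ` Y \<subseteq> {0<..<M} \<times> {0<..<1}) \<and>
     (\<forall>Y\<in>G. \<phi> ` Y \<subseteq> band P) \<and> (\<forall>Y\<in>G. \<forall>Z\<in>F. Z \<inter> \<phi> ` Y = {}) \<and>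
     (\<forall>Q\<in>\<Q>. band (\<sigma> Q) \<subseteq> band P) \<and> (\<forall>Q\<in>\<Q>. probe (F \<union> (`) \<phi> ` G) M (\<sigma> Q)) \<and>
     (\<forall>Q\<in>\<Q>. probe_met (F \<union> (`) \<phi> ` G) M (\<sigma> Q) = probe_met F M P \<union> (`) \<phi> ` probe_met G N Q) \<and>
     (\<forall>Q\<in>\<Q>. \<forall>R\<in>\<Q>. Q \<noteq> R \<longrightarrow> band (\<sigma> Q) \<inter> band (\<sigma> R) = {})"

lemma places_copyD:
  assumes "places_copy X F M P G \<Q> N \<phi> \<sigma>"
  shows "inj \<phi>" "Y \<in> G \<Longrightarrow> scaled_translate_of X (\<phi> ` Y)" "Y \<in> G \<Longrightarrow> \<phi> ` Y \<subseteq> {0<..<M} \<times> {0<..<1}"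
    and "Y \<in> G \<Longrightarrow> \<phi> ` Y \<subseteq> band P" "Y \<in> G \<Longrightarrow> Z \<in> F \<Longrightarrow> Z \<inter> \<phi> ` Y = {}"
    and "Q \<in> \<Q> \<Longrightarrow> band (\<sigma> Q) \<subseteq> band P" "Q \<in> \<Q> \<Longrightarrow> probe (F \<union> (`) \<phi> ` G) M (\<sigma> Q)"
    and "Q \<in> \<Q> \<Longrightarrow> probe_met (F \<union> (`) \<phi> ` G) M (\<sigma> Q) = probe_met F M P \<union> (`) \<phi> ` probe_met G N Q"
    and "Q \<in> \<Q> \<Longrightarrow> R \<in> \<Q> \<Longrightarrow> Q \<noteq> R \<Longrightarrow> band (\<sigma> Q) \<inter> band (\<sigma> R) = {}"
  using assms unfolding places_copy_def by simp_all

text \<open>The box of \<open>G\<close> is scaled into the free space of \<open>P\<close>, which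
  contains no point of a set of \<open>F\<close>. The strip of a moved probe is a thinner part of
  the strip of \<open>P\<close>, and the crossings restrict to it by
  \<open>crosses_vertically_shrink\<close>.\<close>

lemma ex_places_copy:
  assumes "probed_family X G \<Q> N" "probe F M P"
  shows "\<exists>\<phi> \<sigma>. places_copy X F M P G \<Q> N \<phi> \<sigma>"
proof -
  note G = probed_familyD[OF assms(1)]
  obtain x0 x1 y0 y1 where P: "P = (x0, x1, y0, y1)" by (cases P) auto
  note probe = probeD[OF assms(2)[unfolded P]]
  have x: "0 < x0" "x0 < x1" "x1 < M" and y: "0 < y0" "y0 < y1" "y1 < 1"
    using probe by simp_all
  define \<alpha> where "\<alpha> = (x1 - x0) / N"
  define \<gamma> where "\<gamma> = y1 - y0"
  have \<alpha>: "\<alpha> > 0" "\<alpha> * N + x0 = x1" and \<gamma>: "\<gamma> > 0" "\<gamma> + y0 = y1"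
    using x y G(1) by (auto simp: \<alpha>_def \<gamma>_def)
  define \<phi> where "\<phi> = aff \<alpha> x0 \<gamma> y0"
  have \<phi>: "\<phi> p = (\<alpha> * fst p + x0, \<gamma> * snd p + y0)" for p
    by (cases p) (simp add: \<phi>_def aff_def)
  have inj: "inj \<phi>" unfolding \<phi>_def using \<alpha> \<gamma> by (intro inj_aff)
  have \<phi>box: "\<phi> p \<in> {x0..x1} \<times> {y0..y1}" if "p \<in> {0<..<N} \<times> {0<..<1}" for p
  proof -
    have "\<alpha> * fst p \<le> \<alpha> * N" "\<gamma> * snd p \<le> \<gamma> * 1" "0 \<le> \<alpha> * fst p" "0 \<le> \<gamma> * snd p"
      using that \<alpha> \<gamma> by (auto intro!: mult_left_mono)
    then show ?thesis unfolding \<phi> using \<alpha>(2) \<gamma>(2) by (simp add: mem_Times_iff)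
  qed
  have box: "\<phi> ` Y \<subseteq> {x0..x1} \<times> {y0..y1}" if "Y \<in> G" for Y
    using G(3)[OF that] \<phi>box by blast
  have "{x0..x1} \<times> {y0..y1} \<subseteq> {0<..<M} \<times> {0<..<1}" "{x0..x1} \<times> {y0..y1} \<subseteq> band P"
    using x y by (auto simp: P band_def)
  then have 1: "\<phi> ` Y \<subseteq> {0<..<M} \<times> {0<..<1}" "\<phi> ` Y \<subseteq> band P" if "Y \<in> G" for Y
    using box[OF that] by blast+
  have 2: "Z \<inter> \<phi> ` Y = {}" if "Y \<in> G" "Z \<in> F" for Y Z
  proof (rule disjoint_subset[OF _ box[OF that(1)]])
    show "Z \<inter> {x0..x1} \<times> {y0..y1} = {}" using probe(7) that(2) by blast
  qed
  have 3: "scaled_translate_of X (\<phi> ` Y)" if "Y \<in> G" for Y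
    unfolding \<phi>_def using G(2)[OF that] \<alpha>(1) \<gamma>(1) by (rule scaled_translate_of_aff_image)
  define \<sigma> where "\<sigma> = (\<lambda>(a0, a1, b0, b1). (\<alpha> * a0 + x0, \<alpha> * a1 + x0, \<gamma> * b0 + y0, \<gamma> * b1 + y0))"
  define F' where "F' = F \<union> (`) \<phi> ` G"
  have 4: "band (\<sigma> Q) \<subseteq> band P \<and> probe F' M (\<sigma> Q) \<and>
       probe_met F' M (\<sigma> Q) = probe_met F M P \<union> (`) \<phi> ` probe_met G N Q" if "Q \<in> \<Q>" for Q
  proof -
    obtain a0 a1 b0 b1 where Q: "Q = (a0, a1, b0, b1)" by (cases Q) auto
    note probeQ = probeD[OF G(5)[OF that, unfolded Q]]
    have a: "0 < a0" "a0 < a1" "a1 < N" and b: "0 < b0" "b0 < b1" "b1 < 1"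
      using probeQ by simp_all
    define z0 where "z0 = \<alpha> * a0 + x0"
    define z1 where "z1 = \<alpha> * a1 + x0"
    define w0 where "w0 = \<gamma> * b0 + y0"
    define w1 where "w1 = \<gamma> * b1 + y0"
    have \<sigma>: "\<sigma> Q = (z0, z1, w0, w1)"
      by (simp add: \<sigma>_def Q z0_def z1_def w0_def w1_def)
    have z: "x0 < z0" "z0 < z1" "z1 < x1"
      using \<alpha>(1) a by (auto simp: z0_def z1_def simp flip: \<alpha>(2))
    have w: "y0 < w0" "w0 < w1" "w1 < y1"
      using \<gamma>(1) b by (auto simp: w0_def w1_def simp flip: \<gamma>(2))
    have F_met: "crosses_vertically Y z1 M w0 w1" if "Y \<in> met F x0 M y0 y1" for Y
    proof -
      have "crosses_vertically Y x1 M y0 y1" using probe(9) that by blast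
      then have "crosses_vertically Y x1 M w0 w1"
        by (rule crosses_vertically_shrink) (use w in auto)
      then show ?thesis by (rule crosses_vertically_mono) (use z in auto)
    qed
    have G_met: "crosses_vertically (\<phi> ` Y) z1 M w0 w1" if "Y \<in> met G a0 N b0 b1" for Y
    proof -
      have "crosses_vertically Y a1 N b0 b1" using probeQ(9) that by blast
      then have "crosses_vertically (\<phi> ` Y) z1 (\<alpha> * N + x0) w0 w1"
        unfolding z1_def w0_def w1_def \<phi>_def using \<alpha>(1) \<gamma>(1) by (rule crosses_vertically_aff)
      then show ?thesis by (rule crosses_vertically_mono) (use \<alpha>(2) x in auto)
    qed
    have meets: "A \<inter> {z0..M} \<times> {w0..w1} \<noteq> {}" if "crosses_vertically A z1 M w0 w1" for A
    proof -
      have "crosses_vertically A z0 M w0 w1"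
        using that by (rule crosses_vertically_mono) (use z in auto)
      then show ?thesis by (rule crosses_vertically_meets)
    qed
    \<comment> \<open>The right bound \<open>a\<close> is supplied separately: it is
      \<open>N\<close>, from the box of \<open>G\<close>, when the met sets are determined, and
      \<open>a1\<close> when the free space is shown to be empty.\<close>
    have \<phi>mem: "p \<in> {a0..a} \<times> {b0..b1}"
      if "\<phi> p \<in> {z0..r} \<times> {w0..w1}" "\<phi> p \<in> {z0..r} \<times> {w0..w1} \<Longrightarrow> fst p \<le> a" for p r a
      using that \<alpha>(1) \<gamma>(1) by (auto simp: \<phi> z0_def w0_def w1_def mem_Times_iff)
    have met': "met F' z0 M w0 w1 = met F x0 M y0 y1 \<union> (`) \<phi> ` met G a0 N b0 b1"
    proof (intro equalityI subsetI)
      fix A assume "A \<in> met F' z0 M w0 w1"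
      then have A: "A \<in> F'" "A \<inter> {z0..M} \<times> {w0..w1} \<noteq> {}" by (auto simp: met_def)
      show "A \<in> met F x0 M y0 y1 \<union> (`) \<phi> ` met G a0 N b0 b1"
      proof (cases "A \<in> F")
        case True
        have "{z0..M} \<times> {w0..w1} \<subseteq> {x0..M} \<times> {y0..y1}" using z w by auto
        then show ?thesis using True A(2) unfolding met_def by blast
      next
        case False
        then obtain Y where Y: "Y \<in> G" "A = \<phi> ` Y" using A(1) by (auto simp: F'_def)
        obtain p where p: "p \<in> Y" "\<phi> p \<in> {z0..M} \<times> {w0..w1}"
          using A(2) unfolding Y(2) image_meets_iff by (rule bexE)
        have "fst p \<le> N" using G(3)[OF Y(1)] p(1) by (auto simp: mem_Times_iff)
        then have "p \<in> {a0..N} \<times> {b0..b1}" using p(2) by (intro \<phi>mem)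
        then have "Y \<inter> {a0..N} \<times> {b0..b1} \<noteq> {}" using p(1) by (meson disjoint_iff)
        then have "Y \<in> met G a0 N b0 b1" using Y(1) by (simp add: met_def)
        then show ?thesis using Y(2) by blast
      qed
    next
      fix A assume A: "A \<in> met F x0 M y0 y1 \<union> (`) \<phi> ` met G a0 N b0 b1"
      then have "crosses_vertically A z1 M w0 w1" using F_met G_met by blast
      moreover have "A \<in> F'" using A by (auto simp: F'_def met_def)
      ultimately show "A \<in> met F' z0 M w0 w1" using meets by (simp add: met_def)
    qed
    have "band (\<sigma> Q) \<subseteq> band P" using w by (auto simp: \<sigma> P band_def)
    moreover have "probe_met F' M (\<sigma> Q) = probe_met F M P \<union> (`) \<phi> ` probe_met G N Q"
      unfolding \<sigma> by (simp add: P Q probe_met_def met')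
    moreover have "probe F' M (\<sigma> Q)"
      unfolding \<sigma> probe_def case_prod_conv met'
    proof (intro conjI ballI impI)
      fix A assume A: "A \<in> F'"
      show "A \<inter> {z0..z1} \<times> {w0..w1} = {}"
      proof (cases "A \<in> F")
        case True
        have "A \<inter> {x0..x1} \<times> {y0..y1} = {}" using probe(7) True by blast
        then show ?thesis by (rule disjoint_subset) (use z w in auto)
      next
        case False
        then obtain Y where Y: "Y \<in> G" "A = \<phi> ` Y" using A by (auto simp: F'_def)
        show ?thesis
        proof (rule ccontr)
          assume "A \<inter> {z0..z1} \<times> {w0..w1} \<noteq> {}"
          then obtain p where p: "p \<in> Y" "\<phi> p \<in> {z0..z1} \<times> {w0..w1}"
            unfolding Y(2) image_meets_iff by (rule bexE)
          have "fst p \<le> a1" using p(2) \<alpha>(1) by (simp add: \<phi> z1_def)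
          then have "p \<in> {a0..a1} \<times> {b0..b1}" using p(2) by (intro \<phi>mem)
          then show False using probeQ(7)[OF Y(1)] p(1) by (meson disjoint_iff)
        qed
      qed
    next
      fix A B assume A: "A \<in> met F x0 M y0 y1 \<union> (`) \<phi> ` met G a0 N b0 b1"
        and B: "B \<in> met F x0 M y0 y1 \<union> (`) \<phi> ` met G a0 N b0 b1" and "A \<noteq> B"
      have met_sub: "Y \<in> met F x0 M y0 y1 \<Longrightarrow> Y \<in> F" "Y \<in> met G a0 N b0 b1 \<Longrightarrow> Y \<in> G" for Y
        by (auto simp: met_def)
      \<comment> \<open>Two sets of \<open>F\<close> are disjoint because \<open>P\<close> meets
        both, a mixed pair because the copy lies in the free space, and two copies because their
        originals are disjoint and \<open>\<phi>\<close> is injective.\<close>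
      from A B show "A \<inter> B = {}"
      proof (elim UnE imageE)
        assume "A \<in> met F x0 M y0 y1" "B \<in> met F x0 M y0 y1"
        then show ?thesis using \<open>A \<noteq> B\<close> by (rule probe(8))
      next
        fix Y assume "A \<in> met F x0 M y0 y1" "B = \<phi> ` Y" "Y \<in> met G a0 N b0 b1"
        then show ?thesis using 2 met_sub by simp
      next
        fix Y assume "B \<in> met F x0 M y0 y1" "A = \<phi> ` Y" "Y \<in> met G a0 N b0 b1"
        then show ?thesis using 2[of Y B] met_sub by (simp add: Int_commute)
      next
        fix Y Z assume *: "A = \<phi> ` Y" "Y \<in> met G a0 N b0 b1" "B = \<phi> ` Z" "Z \<in> met G a0 N b0 b1"
        then have "Y \<inter> Z = {}" using \<open>A \<noteq> B\<close> by (intro probeQ(8)) auto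
        then show ?thesis using * inj by (simp add: inj_image_disjoint_iff)
      qed
    next
      fix A assume "A \<in> met F x0 M y0 y1 \<union> (`) \<phi> ` met G a0 N b0 b1"
      then show "crosses_vertically A z1 M w0 w1" using F_met G_met by blast
    qed (use x y z w in linarith)+
    ultimately show ?thesis by blast
  qed
  have 5: "band (\<sigma> Q) \<inter> band (\<sigma> R) = {}" if QR: "Q \<in> \<Q>" "R \<in> \<Q>" "Q \<noteq> R" for Q R
  proof -
    \<comment> \<open>The band of a moved probe lies in the image of the original band, with
      explicit preimage \<open>q\<close>; disjointness of bands then passes through the injective
      \<open>\<phi>\<close>.\<close>
    have "p \<in> \<phi> ` band S" if "p \<in> band (\<sigma> S)" for p S
    proof -
      obtain a0 a1 b0 b1 where S: "S = (a0, a1, b0, b1)" by (cases S) auto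
      define q where "q = ((fst p - x0) / \<alpha>, (snd p - y0) / \<gamma>)"
      have "\<phi> q = p" using \<alpha>(1) \<gamma>(1) by (simp add: \<phi> q_def)
      moreover have "q \<in> band S"
        using that \<gamma>(1) by (auto simp: S band_def \<sigma>_def q_def field_simps mem_Times_iff)
      ultimately show ?thesis by blast
    qed
    moreover have "\<phi> ` band Q \<inter> \<phi> ` band R = {}"
      using G(6)[OF QR] inj by (simp add: inj_image_disjoint_iff)
    ultimately show ?thesis by blast
  qed
  show ?thesis
    unfolding places_copy_def
    using 4 unfolding F'_def
    by (intro exI[of _ \<phi>] exI[of _ \<sigma>] conjI ballI impI inj 1 2 3 5) simp_all
qed

text \<open>A copy of \<open>G\<close> goes into the free space of each probe of \<open>F\<close>,
  and the moved probes replace the old ones. In any coloring some \<open>P\<close> shows at least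
  \<open>k\<close> colors; with these as \<open>A\<close>, \<open>forces_new_color\<close> for the
  copy in \<open>P\<close> yields a moved probe that sees both families and shows
  \<open>Suc k\<close> colors.\<close>

lemma ex_forces_colors_Suc:
  assumes "probed_family X F \<P> M" "forces_colors F \<P> M k"
    and "probed_family X G \<Q> N" "forces_new_color G \<Q> N k"
  shows "\<exists>H \<R>. probed_family X H \<R> M \<and> forces_colors H \<R> M (Suc k)"
proof -
  note F = probed_familyD[OF assms(1)] and G = probed_familyD[OF assms(3)]
  obtain \<phi> \<sigma> where copy: "\<And>P. P \<in> \<P> \<Longrightarrow> places_copy X F M P G \<Q> N (\<phi> P) (\<sigma> P)"
    using ex_places_copy[OF assms(3) F(5)] by metis
  note \<phi> = places_copyD(1-5)[OF copy]
  note \<sigma> = places_copyD(6-9)[OF copy]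
  define \<G> where "\<G> P = (`) (\<phi> P) ` G" for P
  define H where "H = F \<union> (\<Union>P\<in>\<P>. \<G> P)"
  define \<R> where "\<R> = (\<Union>P\<in>\<P>. \<sigma> P ` \<Q>)"
  have sub: "F \<union> \<G> P \<subseteq> H" if "P \<in> \<P>" for P using that by (auto simp: H_def)
  have \<G>_band: "Y \<subseteq> band P" if "P \<in> \<P>" "Y \<in> \<G> P" for P Y
    using \<phi>(4)[OF that(1)] that(2) unfolding \<G>_def by blast
  have rest: "Y \<inter> band (\<sigma> P Q) = {}"
    if P: "P \<in> \<P>" and Q: "Q \<in> \<Q>" and Y: "Y \<in> H - (F \<union> \<G> P)" for P Q Y
  proof -
    obtain R where R: "R \<in> \<P>" "Y \<in> \<G> R" "R \<noteq> P" using Y unfolding H_def by blast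
    then have "Y \<inter> band P = {}" using \<G>_band[OF R(1,2)] F(6)[OF R(1) P R(3)] by blast
    then show ?thesis using \<sigma>(1)[OF P Q] by blast
  qed
  have mets: "probe_met H M (\<sigma> P Q) = probe_met F M P \<union> (`) (\<phi> P) ` probe_met G N Q"
    if "P \<in> \<P>" "Q \<in> \<Q>" for P Q
    using probe_met_superfamily[OF sub[OF that(1)] rest[OF that]] \<sigma>(3)[OF that] by (simp add: \<G>_def)
  have "probed_family X H \<R> M"
    unfolding probed_family_def
  proof (intro conjI ballI impI)
    show "0 < M" by (rule F(1))
  next
    fix Y assume "Y \<in> H"
    then consider "Y \<in> F" | P Z where "P \<in> \<P>" "Z \<in> G" "Y = \<phi> P ` Z" unfolding H_def \<G>_def by blast
    then show "scaled_translate_of X Y" using F(2) \<phi>(2) by cases auto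
  next
    fix Y assume "Y \<in> H"
    then consider "Y \<in> F" | P Z where "P \<in> \<P>" "Z \<in> G" "Y = \<phi> P ` Z" unfolding H_def \<G>_def by blast
    then show "Y \<subseteq> {0<..<M} \<times> {0<..<1}"
    proof cases
      case 1
      then show ?thesis by (rule F(3))
    next
      case 2
      then show ?thesis using \<phi>(3) by simp
    qed
  next
    have "triangle_free (\<Union>P\<in>\<P>. \<G> P)"
    proof (rule triangle_free_UN)
      fix P assume "P \<in> \<P>"
      then show "triangle_free (\<G> P)"
        unfolding \<G>_def using \<phi>(1) G(4) by (intro triangle_free_image)
    next
      fix P Q A B assume "P \<in> \<P>" "Q \<in> \<P>" "P \<noteq> Q" "A \<in> \<G> P" "B \<in> \<G> Q"
      then show "A \<inter> B = {}" using \<G>_band[of P A] \<G>_band[of Q B] F(6)[of P Q] by blast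
    qed
    with F(4) show "triangle_free H"
      unfolding H_def
    proof (rule triangle_free_Un)
      fix A B assume "A \<in> F" "B \<in> (\<Union>P\<in>\<P>. \<G> P)"
      then obtain P Y where "P \<in> \<P>" "Y \<in> G" "B = \<phi> P ` Y" unfolding \<G>_def by blast
      then show "A \<inter> B = {}" using \<phi>(5) \<open>A \<in> F\<close> by simp
    qed
  next
    fix R assume "R \<in> \<R>"
    then obtain P Q where PQ: "P \<in> \<P>" "Q \<in> \<Q>" "R = \<sigma> P Q" unfolding \<R>_def by blast
    then show "probe H M R"
      using probe_superfamily[OF sub rest] \<sigma>(2) unfolding \<G>_def by blast
  next
    fix R S assume RS: "R \<in> \<R>" "S \<in> \<R>" "R \<noteq> S"
    obtain P Q where P: "P \<in> \<P>" "Q \<in> \<Q>" "R = \<sigma> P Q" using RS(1) unfolding \<R>_def by blast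
    obtain P' Q' where P': "P' \<in> \<P>" "Q' \<in> \<Q>" "S = \<sigma> P' Q'" using RS(2) unfolding \<R>_def by blast
    show "band R \<inter> band S = {}"
    proof (cases "P = P'")
      case True
      then show ?thesis using \<sigma>(4)[of P Q Q'] P P' RS(3) by blast
    next
      case False
      then show ?thesis using F(6)[of P P'] \<sigma>(1)[of P Q] \<sigma>(1)[of P' Q'] P P' by blast
    qed
  qed
  moreover have "forces_colors H \<R> M (Suc k)"
    unfolding forces_colors_def
  proof (intro allI impI)
    fix n f assume f: "proper_coloring (intersection_graph H) n f"
    have fF: "proper_coloring (intersection_graph F) n f"
      using f by (rule proper_coloring_subset) (simp add: H_def)
    then obtain P where P: "P \<in> \<P>" "k \<le> card (f ` probe_met F M P)"
      using assms(2) unfolding forces_colors_def by blast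
    have "proper_coloring (intersection_graph (\<G> P)) n f"
      using f by (rule proper_coloring_subset) (use sub[OF P(1)] in simp)
    then have "proper_coloring (intersection_graph G) n (f \<circ> (`) (\<phi> P))"
      unfolding \<G>_def using \<phi>(1)[OF P(1)] by (intro proper_coloring_image)
    then obtain Q where Q: "Q \<in> \<Q>"
      "Suc k \<le> card (f ` probe_met F M P \<union> (f \<circ> (`) (\<phi> P)) ` probe_met G N Q)"
      using assms(4) P(2) finite_colors[OF fF probe_met_subset] unfolding forces_new_color_def by blast
    have "Suc k \<le> card (f ` probe_met H M (\<sigma> P Q))"
      using Q(2) by (simp add: mets[OF P(1) Q(1)] image_Un image_comp)
    then show "\<exists>R\<in>\<R>. Suc k \<le> card (f ` probe_met H M R)"
      using P(1) Q(1) unfolding \<R>_def by blast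
  qed
  ultimately show ?thesis by blast
qed

section \<open>Induction over \<open>k\<close> and the resulting bound on colors\<close>

lemma ex_forces_colors:
  assumes "notched X"
  shows "\<exists>F \<P> M. probed_family X F \<P> M \<and> forces_colors F \<P> M k"
proof (induction k)
  case 0
  \<comment> \<open>Even for \<open>k = 0\<close>, \<open>forces_colors\<close> asks for some probe
    to exist, so the empty family is given one.\<close>
  have "probed_family X {} {(1/4, 1/2, 1/4, 1/2)} 1"
    by (auto simp: probed_family_def probe_def met_def triangle_free_def)
  moreover have "forces_colors {} {(1/4, 1/2, 1/4, 1/2)} 1 0"
    by (simp add: forces_colors_def)
  ultimately show ?case by blast
next
  case (Suc k)
  then show ?case using ex_forces_new_color[OF assms] ex_forces_colors_Suc by meson
qed

lemma notched_not_colorable: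
  assumes "notched X"
  shows "\<exists>F. (\<forall>Y\<in>F. scaled_translate_of X Y) \<and> triangle_free F \<and>
    (\<forall>n f. proper_coloring (intersection_graph F) n f \<longrightarrow> k < n)"
proof -
  \<comment> \<open>\<open>Suc k\<close> colors below \<open>n\<close> in one probe give the strict
    inequality \<open>k < n\<close>.\<close>
  obtain F \<P> M where F: "probed_family X F \<P> M" "forces_colors F \<P> M (Suc k)"
    using ex_forces_colors[OF assms] by blast
  have "k < n" if f: "proper_coloring (intersection_graph F) n f" for n f
  proof -
    obtain P where "P \<in> \<P>" "Suc k \<le> card (f ` probe_met F M P)"
      using F(2) f unfolding forces_colors_def by blast
    moreover have "f ` probe_met F M P \<subseteq> {..<n}"
      using f probe_met_subset unfolding proper_coloring_intersection_graph by blast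
    then have "card (f ` probe_met F M P) \<le> n"
      using card_mono[of "{..<n}"] by simp
    ultimately show ?thesis by simp
  qed
  then show ?thesis using probed_familyD(2,4)[OF F(1)] by blast
qed

section \<open>Arc-connected sets that are not rectangles\<close>

definition reflect :: "real \<times> real \<Rightarrow> real \<times> real" where
  "reflect = (\<lambda>(x, y). (- x, y))"

text \<open>Conjugating \<open>aff a b c d\<close> with the reflection changes only the sign of
  \<open>b\<close>; the scale factors stay positive. Reflecting the copies of the mirror image
  therefore gives admissible copies of \<open>X\<close>.\<close>

lemma reflected_notched_not_colorable:
  assumes "notched (reflect ` X)"
  shows "\<exists>F. (\<forall>Y\<in>F. scaled_translate_of X Y) \<and> triangle_free F \<and>
    (\<forall>n f. proper_coloring (intersection_graph F) n f \<longrightarrow> k < n)"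
proof -
  have inj: "inj reflect" by (auto simp: inj_def reflect_def)
  obtain F where F: "\<forall>Y\<in>F. scaled_translate_of (reflect ` X) Y" "triangle_free F"
    "\<forall>n f. proper_coloring (intersection_graph F) n f \<longrightarrow> k < n"
    using notched_not_colorable[OF assms] by blast
  have "scaled_translate_of X (reflect ` Y)" if Y: "Y \<in> F" for Y
  proof -
    obtain a b c d where "0 < a" "0 < c" "Y = aff a b c d ` reflect ` X"
      using bspec[OF F(1) Y] unfolding scaled_translate_of_def aff_def by blast
    moreover have "reflect (aff a b c d (reflect p)) = aff a (- b) c d p" for p
      by (cases p) (simp add: reflect_def aff_def)
    ultimately show ?thesis
      using scaled_translate_of_aff[of a c X "- b" d] by (simp add: image_image)
  qed
  moreover have "triangle_free ((`) reflect ` F)"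
    using inj F(2) by (rule triangle_free_image)
  moreover have "k < n" if "proper_coloring (intersection_graph ((`) reflect ` F)) n f" for n f
    using F(3) proper_coloring_image[OF inj that] by blast
  ultimately show ?thesis by blast
qed

text \<open>By compactness \<open>X\<close> touches each side of its bounding box. If
  \<open>X\<close> contained the open box, it would, being closed, be the whole box; so some small
  rectangle inside is missed by \<open>X\<close>. The side on which a crossing passes it decides
  between \<open>X\<close> and its mirror image.\<close>

lemma ex_notched:
  assumes "arc_connected X" "compact X" "\<not> axis_aligned_rectangle X"
  shows "notched X \<or> notched (reflect ` X)"
proof -
  have ne: "X \<noteq> {}" using assms(1) by (simp add: arc_connected_def)
  have path: "\<exists>g. path g \<and> path_image g \<subseteq> X \<and> pathstart g = p \<and> pathfinish g = q"
    if "p \<in> X" "q \<in> X" for p q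
  \<comment> \<open>\<open>arc_connected\<close> speaks of distinct points only; equal points are
    joined by a constant path.\<close>
  proof (cases "p = q")
    case True
    then show ?thesis using that by (intro exI[of _ "linepath p p"]) auto
  next
    case False
    then show ?thesis using assms(1) that unfolding arc_connected_def by (meson arc_imp_path)
  qed
  have cont: "continuous_on X fst" "continuous_on X snd" by (intro continuous_intros)+
  obtain pa where pa: "pa \<in> X" "\<And>p. p \<in> X \<Longrightarrow> fst pa \<le> fst p"
    using continuous_attains_inf[OF assms(2) ne cont(1)] by blast
  obtain pb where pb: "pb \<in> X" "\<And>p. p \<in> X \<Longrightarrow> fst p \<le> fst pb"
    using continuous_attains_sup[OF assms(2) ne cont(1)] by blast
  obtain pc where pc: "pc \<in> X" "\<And>p. p \<in> X \<Longrightarrow> snd pc \<le> snd p"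
    using continuous_attains_inf[OF assms(2) ne cont(2)] by blast
  obtain pd where pd: "pd \<in> X" "\<And>p. p \<in> X \<Longrightarrow> snd p \<le> snd pd"
    using continuous_attains_sup[OF assms(2) ne cont(2)] by blast
  define a b c d where "a = fst pa" "b = fst pb" "c = snd pc" "d = snd pd"
  note defs = this
  have X: "X \<subseteq> {a..b} \<times> {c..d}" using pa pb pc pd by (auto simp: defs mem_Times_iff)
  obtain g where g: "path g" "path_image g \<subseteq> X" "fst (pathstart g) = a" "fst (pathfinish g) = b"
    using path[OF pa(1) pb(1)] defs by blast
  obtain f where f: "path f" "path_image f \<subseteq> X" "snd (pathstart f) = c" "snd (pathfinish f) = d"
    using path[OF pc(1) pd(1)] defs by blast
  have "connected (fst ` path_image g)" "connected (snd ` path_image f)"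
    using g(1) f(1) by (auto intro!: connected_continuous_image connected_path_image continuous_intros)
  moreover have "a \<in> fst ` path_image g" "b \<in> fst ` path_image g"
    "c \<in> snd ` path_image f" "d \<in> snd ` path_image f"
    using g f by (metis imageI pathstart_in_path_image pathfinish_in_path_image)+
  ultimately have "{a..b} \<subseteq> fst ` path_image g" "{c..d} \<subseteq> snd ` path_image f"
    by (simp_all add: connected_contains_Icc)
  then have proj: "{a..b} \<subseteq> fst ` X" "{c..d} \<subseteq> snd ` X"
    using g(2) f(2) by blast+
  have le: "a \<le> b" "c \<le> d" using pa pb pc pd by (auto simp: defs)
  have not_rect: "X \<noteq> {a..b} \<times> {c..d}"
    using assms(3) le unfolding axis_aligned_rectangle_def by blast
  \<comment> \<open>If the box had no width, \<open>X\<close>, which projects onto all of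
    \<open>{c..d}\<close>, would be a vertical segment or a point, hence a degenerate
    rectangle.\<close>
  have "a \<noteq> b"
  proof
    assume "a = b"
    have "q \<in> X" if "q \<in> {a..b} \<times> {c..d}" for q
    proof -
      have "snd q \<in> snd ` X" using that proj(2) by (auto simp: mem_Times_iff)
      then obtain r where r: "r \<in> X" "snd r = snd q" by auto
      then have "fst r = fst q" using X that \<open>a = b\<close> by (force simp: mem_Times_iff)
      then show ?thesis using r by (metis prod_eqI)
    qed
    then show False using not_rect X by blast
  qed
  moreover have "c \<noteq> d"
  proof
    assume "c = d"
    have "q \<in> X" if "q \<in> {a..b} \<times> {c..d}" for q
    proof -
      have "fst q \<in> fst ` X" using that proj(1) by (auto simp: mem_Times_iff)
      then obtain r where r: "r \<in> X" "fst r = fst q" by auto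
      then have "snd r = snd q" using X that \<open>c = d\<close> by (force simp: mem_Times_iff)
      then show ?thesis using r by (metis prod_eqI)
    qed
    then show False using not_rect X by blast
  qed
  ultimately have lt: "a < b" "c < d" using le by auto
  have closed: "closed X" using assms(2) by (rule compact_imp_closed)
  have "\<not> {a<..<b} \<times> {c<..<d} \<subseteq> X"
  proof
    assume "{a<..<b} \<times> {c<..<d} \<subseteq> X"
    then have "closure ({a<..<b} \<times> {c<..<d}) \<subseteq> X" using closed by (rule closure_minimal)
    then show False using not_rect X lt by (simp add: closure_Times)
  qed
  then obtain q where q: "q \<in> {a<..<b} \<times> {c<..<d} - X" by blast
  have "open ({a<..<b} \<times> {c<..<d} - X)"
    using closed by (intro open_Diff open_Times) auto
  then obtain A B where AB: "open A" "open B" "q \<in> A \<times> B" "A \<times> B \<subseteq> {a<..<b} \<times> {c<..<d} - X"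
    using q by (rule open_prod_elim)
  have Icc: "\<exists>x0 x1. x0 < x1 \<and> {x0..x1} \<subseteq> S" if S: "open S" "x \<in> S" for S :: "real set" and x
  proof -
    obtain e where "0 < e" "cball x e \<subseteq> S" using S open_contains_cball by blast
    then show ?thesis by (intro exI[of _ "x - e"] exI[of _ "x + e"]) (simp add: cball_eq_atLeastAtMost)
  qed
  obtain u u' where u: "u < u'" "{u..u'} \<subseteq> A" using Icc[OF AB(1)] AB(3) by (metis mem_Times_iff)
  obtain v v' where v: "v < v'" "{v..v'} \<subseteq> B" using Icc[OF AB(2)] AB(3) by (metis mem_Times_iff)
  have hole: "{u..u'} \<times> {v..v'} \<subseteq> {a<..<b} \<times> {c<..<d} - X"
    using u(2) v(2) AB(4) by (meson Sigma_mono order_trans)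
  have "(u, v) \<in> {u..u'} \<times> {v..v'}" "(u', v') \<in> {u..u'} \<times> {v..v'}" using u(1) v(1) by auto
  from this[THEN subsetD[OF hole]] have uv: "a < u" "u' < b" "c < v" "v' < d" by auto
  have gap: "X \<inter> {u..u'} \<times> {v..v'} = {}" using hole by (meson DiffD2 disjoint_iff subsetD)
  have "crosses_vertically X a b c d"
    unfolding crosses_vertically_def
    by (intro exI[of _ f] conjI Int_greatest order_trans[OF f(2) X] f)
  then have "crosses_vertically X a b v v'"
    by (rule crosses_vertically_shrink) (use uv v in auto)
  then obtain h where h: "path h" "path_image h \<subseteq> X \<inter> {a..b} \<times> {v..v'}"
    "snd (pathstart h) = v" "snd (pathfinish h) = v'"
    unfolding crosses_vertically_def by blast
  have conn: "connected (fst ` path_image h)"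
    using h(1) by (auto intro!: connected_continuous_image connected_path_image continuous_intros)
  have avoid: "fst r \<notin> {u..u'}" if "r \<in> path_image h" for r
  proof
    assume "fst r \<in> {u..u'}"
    then have "r \<in> X" "r \<in> {u..u'} \<times> {v..v'}"
      using subsetD[OF h(2) that] by (auto simp: mem_Times_iff)
    then show False using gap by (meson disjoint_iff)
  qed
  \<comment> \<open>The horizontal projection of the crossing is connected and avoids
    \<open>{u..u'}\<close>, so it lies on one side.\<close>
  have sides: "(\<forall>r\<in>path_image h. u' \<le> fst r) \<or> (\<forall>r\<in>path_image h. fst r \<le> u)"
  proof (rule ccontr)
    assume "\<not> ?thesis"
    then obtain r s where rs: "r \<in> path_image h" "s \<in> path_image h" "fst r < u'" "u < fst s"
      by (auto simp: not_le)
    then have "fst r < u" "u' < fst s" using avoid[OF rs(1)] avoid[OF rs(2)] by auto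
    then have "u \<in> {fst r..fst s}" using u(1) by auto
    moreover have "{fst r..fst s} \<subseteq> fst ` path_image h"
      using rs conn by (intro connected_contains_Icc) auto
    ultimately obtain t where "t \<in> path_image h" "fst t = u" by auto
    then show False using avoid[of t] u(1) by auto
  qed
  then show ?thesis
  proof
    assume "\<forall>r\<in>path_image h. u' \<le> fst r"
    then have "path_image h \<subseteq> X \<inter> {u'..b} \<times> {v..v'}" using h(2) by (fastforce simp: mem_Times_iff)
    then have "crosses_vertically X u' b v v'" 
      unfolding crosses_vertically_def using h(1,3,4) by (intro exI[of _ h] conjI)
    with X uv(1) u(1) uv(2) less_imp_le[OF uv(3)] v(1) less_imp_le[OF uv(4)] gap
    have "notched X" using g by (rule notchedI)
    then show ?thesis by blast
  next
    assume "\<forall>r\<in>path_image h. fst r \<le> u"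
    then have h': "path_image h \<subseteq> X \<inter> {a..u} \<times> {v..v'}" using h(2) by (fastforce simp: mem_Times_iff)
    have cont: "continuous_on S reflect" for S
      unfolding reflect_def case_prod_unfold by (intro continuous_intros)
    have reflect: "fst (reflect q) = - fst q" "snd (reflect q) = snd q" for q
      by (auto simp: reflect_def case_prod_unfold)
    have "path_image (reflect \<circ> h) \<subseteq> reflect ` X \<inter> {- u..- a} \<times> {v..v'}"
    proof
      fix q assume "q \<in> path_image (reflect \<circ> h)"
      then obtain p where p: "p \<in> path_image h" "q = reflect p"
        unfolding path_image_compose by (rule imageE)
      then show "q \<in> reflect ` X \<inter> {- u..- a} \<times> {v..v'}"
        using subsetD[OF h' p(1)] by (simp add: reflect mem_Times_iff)
    qed
    then have cr: "crosses_vertically (reflect ` X) (- u) (- a) v v'"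
      unfolding crosses_vertically_def using h(1,3,4) cont
      by (intro exI[of _ "reflect \<circ> h"])
        (simp add: path_continuous_image pathstart_compose pathfinish_compose reflect)
    \<comment> \<open>Reflection exchanges the left and right ends, so \<open>g\<close> is reversed
      to run from left to right again.\<close>
    have "path (reflect \<circ> reversepath g)" "path_image (reflect \<circ> reversepath g) \<subseteq> reflect ` X"
      "fst (pathstart (reflect \<circ> reversepath g)) = - b" "fst (pathfinish (reflect \<circ> reversepath g)) = - a"
      using g cont
      by (auto simp: path_image_compose pathstart_compose pathfinish_compose reflect
          intro!: path_continuous_image)
    note refl_g = this
    have refl_box: "reflect ` X \<subseteq> {- b..- a} \<times> {c..d}"
    proof
      fix q assume "q \<in> reflect ` X"
      then obtain p where p: "p \<in> X" "q = reflect p" by (rule imageE)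
      then show "q \<in> {- b..- a} \<times> {c..d}"
        using subsetD[OF X p(1)] by (simp add: reflect mem_Times_iff)
    qed
    have refl_gap: "reflect ` X \<inter> {- u'..- u} \<times> {v..v'} = {}"
    proof (rule ccontr)
      assume "reflect ` X \<inter> {- u'..- u} \<times> {v..v'} \<noteq> {}"
      then obtain p where p: "p \<in> X" "reflect p \<in> {- u'..- u} \<times> {v..v'}"
        unfolding image_meets_iff by (rule bexE)
      then have "p \<in> {u..u'} \<times> {v..v'}" by (simp add: reflect mem_Times_iff)
      then show False using gap p(1) by (meson disjoint_iff)
    qed
    have "notched (reflect ` X)"
      by (rule notchedI[OF refl_box _ _ _ _ _ _ refl_gap cr refl_g]) (use uv u(1) v(1) in simp_all)
    then show ?thesis by blast
  qed
qed

theorem theorem1: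
  fixes X :: "(real \<times> real) set" and k :: nat
  assumes "arc_connected X" and "compact X" and "\<not> axis_aligned_rectangle X"
    and "k \<ge> 1"
  shows "\<exists>F :: (real \<times> real) set set.
           (\<forall>Y\<in>F. scaled_translate_of X Y) \<and> triangle_free F \<and>
           chromatic_number (intersection_graph F) > enat k"
proof -
  obtain F where F: "\<forall>Y\<in>F. scaled_translate_of X Y" "triangle_free F"
    "\<And>n f. proper_coloring (intersection_graph F) n f \<Longrightarrow> k < n"
    using ex_notched[OF assms(1-3)] notched_not_colorable reflected_notched_not_colorable by metis
  \<comment> \<open>Each sufficient number of colors is at least \<open>Suc k\<close>; if there is
    none, the infimum is infinite and the bound holds as well.\<close>
  have "enat (Suc k) \<le> chromatic_number (intersection_graph F)"
    unfolding chromatic_number_def by (rule Inf_greatest) (use F(3) in \<open>auto simp: Suc_le_eq\<close>)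
  then have "enat k < chromatic_number (intersection_graph F)"
    by (rule less_le_trans[rotated]) simp
  then show ?thesis using F(1,2) by blast
qed

end
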